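(* Let $\Bbbk$ be an algebraically closed field of characteristic zero. Let $H = \Bbbk\langle x,y,z \mid xz-zx,\ yz-zy,\ f\rangle$, where $f\in\Bbbk\langle x,y,z\rangle$ is homogeneous of degree two and at least one of the coefficients of $x^2, xy, yx, y^2$ in $f$ is nonzero. Then $H$ is isomorphic to one of the following algebras $\Bbbk\langle x,y,z \mid xz-zx,\ yz-zy,\ f\rangle$, with one representative of $f$ given in each case: \begin{itemize} \item $H(\mathcal{O}_q(\Bbbk^2))$, $f=xy-qyx$ ($q\in\Bbbk^\times$); \item $H(A_1^q(\Bbbk))$, $f=xy-qyx-z^2$ ($q\in\Bbbk^\times$); \item $H(\mathcal{J})$, $f=yx-xy+y^2$; \item $H(\mathcal{J}_1)$, $f=yx-xy+y^2+z^2$; \item $H(\mathfrak{U})$, $f=yx-xy+yz$; \item $H(\mathfrak{V})$, $f=yx-xy+y^2+xz$; \item $H(R_{x^2})$, $f=x^2$; \item $H(R_{x^2-1})$, $f=x^2-z^2$; \item $H(R_{yx})$, $f=yx$; \item $H(\mathcal{S})$, $f=yx-z^2$; \item $H(\Bbbk[x])$, $f=x^2+yz$. \end{itemize} Furthermore, the algebras $H(\mathcal{O}_q(\Bbbk^2))$ ($q\in\Bbbk^\times$), $H(A_1^q(\Bbbk))$ ($q\in\Bbbk^\times$), $H(\mathcal{J})$, $H(\mathcal{J}_1)$, $H(\mathfrak{U})$, $H(\mathfrak{V})$, $H(R_{x^2})$, $H(R_{x^2-1})$, $H(R_{yx})$, $H(\mathcal{S})$ and $H(\Bbbk[x])$ are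 pairwise non-isomorphic, except that $H(\mathcal{O}_q(\Bbbk^2))\cong H(\mathcal{O}_{q^{-1}}(\Bbbk^2))$ and $H(A_1^q(\Bbbk))\cong H(A_1^{q^{-1}}(\Bbbk))$ for $q\in\Bbbk^\times$.
   Context: $\Bbbk\langle x,y,z \mid r_1,r_2,\dots\rangle$ denotes the quotient of the free associative unital $\Bbbk$-algebra on $x,y,z$ (each of degree one) by the two-sided ideal generated by the listed elements. All isomorphisms are isomorphisms of (ungraded) $\Bbbk$-algebras. The symbols $H(\cdot)$ are just names for the algebras defined by the displayed $f$. *)

theory Defs
  imports
    "HOL-Library.Poly_Mapping"
    "HOL-Computational_Algebra.Computational_Algebra"
    "HOL-Algebra.QuotRing"
    "HOL-Algebra.Module"
begin

subsection \<open>Free associative algebras\<close>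

text \<open>The free monoid, written additively so that the convolution product of
  \<^theory>\<open>HOL-Library.Poly_Mapping\<close> applies: the monoid algebra of the free monoid is the
  free associative unital algebra.\<close>

datatype 'g word = Word (letters: "'g list")

instantiation word :: (type) monoid_add
begin

definition zero_word :: "'a word" where "0 = Word []"

definition plus_word :: "'a word \<Rightarrow> 'a word \<Rightarrow> 'a word"
  where "u + v = Word (letters u @ letters v)"

instance
  by standard (simp_all add: zero_word_def plus_word_def)

end

type_synonym ('g, 'k) free_alg = "'g word \<Rightarrow>\<^sub>0 'k"

definition scale :: "'k \<Rightarrow> ('g, 'k) free_alg \<Rightarrow> ('g, 'k::field) free_alg"  (infixr \<open>\<bullet>\<close> 75)
  where "c \<bullet> p = Poly_Mapping.map (\<lambda>a. c * a) p"

definition homogeneous :: "nat \<Rightarrow> ('g, 'k::field) free_alg \<Rightarrow> bool"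
  where "homogeneous d p \<longleftrightarrow> (\<forall>w \<in> Poly_Mapping.keys p. length (letters w) = d)"

text \<open>Algebras over the field given by a type \<open>'k\<close> are records of type \<open>('k, _) module\<close>,
  i.e. rings (not necessarily commutative) together with a scalar multiplication.\<close>

definition free_algebra :: "('k::field, ('g, 'k) free_alg) module"
  where "free_algebra =
    \<lparr>carrier = UNIV, monoid.mult = (*), one = 1, ring.zero = 0, add = (+), smult = scale\<rparr>"

lemma ring_free_algebra: "ring (free_algebra :: ('k::field, ('g, 'k) free_alg) module)"
proof -
  have "\<exists>q. p + q = 0" for p :: "('g, 'k) free_alg"
    by (rule exI[of _ "- p"]) simp
  moreover have "\<exists>q. q + p = 0" for p :: "('g, 'k) free_alg"
    by (rule exI[of _ "- p"]) simp
  ultimately show ?thesis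
    by unfold_locales (auto simp: free_algebra_def algebra_simps Units_def)
qed

lemma lookup_scale: "Poly_Mapping.lookup (c \<bullet> p) w = c * Poly_Mapping.lookup p w"
  by (simp add: scale_def Poly_Mapping.map.rep_eq when_def)


subsection \<open>Quotient algebras and isomorphisms\<close>

text \<open>The library's quotient ring by a two-sided ideal, with scalar multiplication on cosets
  defined in the same style as the library's product of cosets.\<close>

definition quot_algebra :: "('k, 'a) module \<Rightarrow> 'a set \<Rightarrow> ('k, 'a set) module"
  where "quot_algebra A I =
    ring.extend (A Quot I) (module.fields (\<lambda>c C. \<Union>a\<in>C. I +>\<^bsub>A\<^esub> (c \<odot>\<^bsub>A\<^esub> a)))"

definition algebra_iso :: "('k, 'a) module \<Rightarrow> ('k, 'b) module \<Rightarrow> ('a \<Rightarrow> 'b) set"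
  where "algebra_iso A B =
    {h \<in> ring_iso A B. \<forall>c. \<forall>a \<in> carrier A. h (c \<odot>\<^bsub>A\<^esub> a) = c \<odot>\<^bsub>B\<^esub> h a}"

definition algebra_isomorphic :: "('k, 'a) module \<Rightarrow> ('k, 'b) module \<Rightarrow> bool"
    (infix \<open>\<cong>\<^sub>a\<^sub>l\<^sub>g\<close> 50)
  where "A \<cong>\<^sub>a\<^sub>l\<^sub>g B \<longleftrightarrow> algebra_iso A B \<noteq> {}"

lemma carrier_quot_algebra: "carrier (quot_algebra A I) = a_rcosets\<^bsub>A\<^esub> I"
  and mult_quot_algebra: "C \<otimes>\<^bsub>quot_algebra A I\<^esub> D = rcoset_mult A I C D"
  and one_quot_algebra: "\<one>\<^bsub>quot_algebra A I\<^esub> = I +>\<^bsub>A\<^esub> \<one>\<^bsub>A\<^esub>"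
  and zero_quot_algebra: "\<zero>\<^bsub>quot_algebra A I\<^esub> = I"
  and add_quot_algebra: "C \<oplus>\<^bsub>quot_algebra A I\<^esub> D = set_add A C D"
  and smult_quot_algebra: "c \<odot>\<^bsub>quot_algebra A I\<^esub> C = (\<Union>a\<in>C. I +>\<^bsub>A\<^esub> (c \<odot>\<^bsub>A\<^esub> a))"
  by (simp_all add: quot_algebra_def FactRing_def ring.defs module.defs)


subsection \<open>The algebras in three generators\<close>

datatype gen = GX | GY | GZ

definition X :: "(gen, 'k::field) free_alg" where "X = Poly_Mapping.single (Word [GX]) 1"
definition Y :: "(gen, 'k::field) free_alg" where "Y = Poly_Mapping.single (Word [GY]) 1"
definition Z :: "(gen, 'k::field) free_alg" where "Z = Poly_Mapping.single (Word [GZ]) 1"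

definition H :: "(gen, 'k::field) free_alg \<Rightarrow> ('k, (gen, 'k) free_alg set) module"
  where "H f = quot_algebra free_algebra (Idl\<^bsub>free_algebra\<^esub> {X * Z - Z * X, Y * Z - Z * Y, f})"

datatype 'k name =
    Quantum_plane 'k  \<comment> \<open>\<open>O_q(k^2)\<close>\<close>
  | Quantum_Weyl 'k   \<comment> \<open>\<open>A_1^q(k)\<close>\<close>
  | J
  | J1
  | U
  | V
  | R_x2              \<comment> \<open>\<open>R_{x^2}\<close>\<close>
  | R_x2_minus_1      \<comment> \<open>\<open>R_{x^2 - 1}\<close>\<close>
  | R_yx
  | S
  | Poly_x            \<comment> \<open>\<open>k[x]\<close>\<close>

fun relator :: "'k::field name \<Rightarrow> (gen, 'k) free_alg" where
  "relator (Quantum_plane q) = X * Y - q \<bullet> (Y * X)"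
| "relator (Quantum_Weyl q) = X * Y - q \<bullet> (Y * X) - Z\<^sup>2"
| "relator J = Y * X - X * Y + Y\<^sup>2"
| "relator J1 = Y * X - X * Y + Y\<^sup>2 + Z\<^sup>2"
| "relator U = Y * X - X * Y + Y * Z"
| "relator V = Y * X - X * Y + Y\<^sup>2 + X * Z"
| "relator R_x2 = X\<^sup>2"
| "relator R_x2_minus_1 = X\<^sup>2 - Z\<^sup>2"
| "relator R_yx = Y * X"
| "relator S = Y * X - Z\<^sup>2"
| "relator Poly_x = X\<^sup>2 + Y * Z"

fun admissible :: "'k::field name \<Rightarrow> bool" where
  "admissible (Quantum_plane q) \<longleftrightarrow> q \<noteq> 0"
| "admissible (Quantum_Weyl q) \<longleftrightarrow> q \<noteq> 0"
| "admissible _ \<longleftrightarrow> True"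

end

theory Submission
  imports Defs "HOL-Analysis.Determinants"
begin

text \<open>All algebras in question are quadratic: the space \<open>V\<close> of generators is subject to a space \<open>T\<close> of
relations in \<open>V \<otimes> V\<close>. With \<open>\<Sum> b\<^sub>i\<^sub>j x\<^sub>i x\<^sub>j\<close> written as the matrix \<open>b\<close>, a linear change of generators with matrix \<open>L\<close>
acts on relations by the congruence \<open>b \<mapsto> L\<^sup>T b L\<close>. The bridge between algebra isomorphisms and linear
algebra is that an isomorphism of quadratic algebras, even an ungraded one, yields an invertible \<open>L\<close>
that maps the relations of the first into those of the second
(\<open>quadratic_algebra_isomorphicD\<close>; the converse is \<open>quadratic_algebra_isomorphicI\<close>). To see this, lift the
isomorphism to a substitution \<open>x\<^sub>i \<mapsto> c\<^sub>i + L\<^sub>i + \<dots>\<close> with constants \<open>c\<^sub>i\<close> and linear forms \<open>L\<^sub>i\<close>. Relations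
start in degree two, so composing with the inverse shows that the \<open>L\<^sub>i\<close> are independent. Substituting
into a relation \<open>r\<close> gives a relation again, whose degree one part vanishes: the
derivative of \<open>r\<close> at \<open>c\<close> is zero. That derivative is also the only way in which the higher terms enter
the degree two part, which is therefore \<open>r(L)\<close>.

For the list of normal forms, consider the relator modulo the commutators of \<open>z\<close>. Its part in \<open>x\<close> and \<open>y\<close>
is a non-zero bilinear form on a plane. As the field is algebraically closed there is an isotropic vector,
and this reduces the form to one of \<open>xx\<close>, \<open>yx\<close>, \<open>xy - qyx\<close>, \<open>yx - xy + yy\<close>. Shifting \<open>x\<close> and \<open>y\<close> by multiples
of \<open>z\<close> removes those linear terms \<open>xz\<close>, \<open>yz\<close> that the symmetric part of the form can reach; what is
left is scaled (\<open>has_normal_form\<close>).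

For the distinctions between the normal forms, the symmetric part of the relator on the three-dimensional
space is defined up to congruence and scaling, hence so is its rank. If it is non-zero, the skew
relations recover the line of \<open>z\<close>, and the bilinear form on the quotient plane is also defined up to
congruence and scaling. The determinant of this form and that of its symmetric part scale together, so their
ratio is invariant, and so is the vanishing of the symmetric part (\<open>isomorphic_imp_same_invariants\<close>).
These data separate all normal forms except \<open>q\<close> from \<open>q\<^sup>-\<^sup>1\<close>.\<close>

(* From here on $ selects matrix entries and \<bullet> is the scalar action on the free algebra. *)
no_notation fps_nth (infixl \<open>$\<close> 75)
unbundle no inner_syntax

section \<open>Substitution in free algebras\<close>

lemma poly_mapping_additive_induct [case_names zero single add]:
  fixes p :: "'a \<Rightarrow>\<^sub>0 'b::ab_group_add"
  assumes "P 0" and "\<And>w c. P (Poly_Mapping.single w c)"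
    and "\<And>p q. P p \<Longrightarrow> P q \<Longrightarrow> P (p + q)"
  shows "P p"
proof (induction p rule: update_induct)
  case (update f a b)
  have "Poly_Mapping.update a b f = f + Poly_Mapping.single a b"
    using update.hyps
    by (intro poly_mapping_eqI) (auto simp: lookup_add lookup_single in_keys_iff when_def lookup_update)
  with update assms show ?case by metis
qed (rule assms)

lemma scale_conv_mult: "c \<bullet> p = Poly_Mapping.single 0 c * p"
  by (simp add: Defs.scale_def mult_map_scale_conv_mult)

lemma scale_add_right: "c \<bullet> (p + q) = c \<bullet> p + c \<bullet> q"
  by (simp add: scale_conv_mult algebra_simps)

lemma scale_zero_right [simp]: "c \<bullet> 0 = 0"
  by (simp add: scale_conv_mult)

lemma scale_single: "c \<bullet> Poly_Mapping.single w a = Poly_Mapping.single w (c * a)"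
  by (simp add: scale_conv_mult mult_single)

lemma scale_scale: "a \<bullet> (b \<bullet> p) = (a * b) \<bullet> p"
  by (simp add: scale_conv_mult mult_single flip: mult.assoc)

lemma scale_one [simp]: "1 \<bullet> p = p"
  by (simp add: scale_conv_mult)

lemma scale_zero_left [simp]: "0 \<bullet> p = 0"
  and scale_minus_left [simp]: "(- c) \<bullet> p = - (c \<bullet> p)"
  by (simp_all add: scale_conv_mult single_uminus)

lemma scale_sum: "c \<bullet> sum f A = (\<Sum>a\<in>A. c \<bullet> f a)"
  by (simp add: scale_conv_mult sum_distrib_left)

lemma mult_scale_left: "(c \<bullet> p) * q = c \<bullet> (p * q)"
  by (simp add: scale_conv_mult mult.assoc)

lemma mult_scale_right: "p * (c \<bullet> q) = c \<bullet> (p * q)"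
proof -
  have "p * Poly_Mapping.single 0 c = Poly_Mapping.single 0 c * p"
    by (induction p rule: poly_mapping_additive_induct)
       (simp_all add: mult_single algebra_simps)
  then show ?thesis
    by (simp add: scale_conv_mult flip: mult.assoc)
qed

definition subst :: "('g \<Rightarrow> ('h, 'k) free_alg) \<Rightarrow> ('g, 'k::field) free_alg \<Rightarrow> ('h, 'k) free_alg"
  where "subst s p =
    (\<Sum>w\<in>Poly_Mapping.keys p. Poly_Mapping.lookup p w \<bullet> prod_list (map s (letters w)))"

lemma subst_superset:
  assumes "finite A" "Poly_Mapping.keys p \<subseteq> A"
  shows "subst s p = (\<Sum>w\<in>A. Poly_Mapping.lookup p w \<bullet> prod_list (map s (letters w)))"
  unfolding subst_def using assms
  by (intro sum.mono_neutral_left) (auto simp: in_keys_iff scale_conv_mult)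

lemma subst_add: "subst s (p + q) = subst s p + subst s q"
proof -
  define A where "A = Poly_Mapping.keys p \<union> Poly_Mapping.keys q"
  have "finite A" "Poly_Mapping.keys p \<subseteq> A" "Poly_Mapping.keys q \<subseteq> A"
      "Poly_Mapping.keys (p + q) \<subseteq> A"
    using Poly_Mapping.keys_add[of p q] by (auto simp: A_def)
  then show ?thesis
    by (simp add: subst_superset[of A] lookup_add sum.distrib scale_conv_mult single_add algebra_simps)
qed

lemma subst_single: "subst s (Poly_Mapping.single w c) = c \<bullet> prod_list (map s (letters w))"
  by (subst subst_superset[of "{w}"]) (auto simp: )

lemma subst_zero [simp]: "subst s 0 = 0"
  by (simp add: subst_def)

lemma subst_uminus: "subst s (- p) = - subst s p"
  using subst_add[of s p "- p"] by (simp add: eq_neg_iff_add_eq_0 add.commute)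

lemma subst_diff: "subst s (p - q) = subst s p - subst s q"
  using subst_add[of s p "- q"] by (simp add: subst_uminus)

lemma subst_one [simp]: "subst s 1 = 1"
  using subst_single[of s 0 1] unfolding single_one by (simp add: zero_word_def)

lemma subst_scale: "subst s (c \<bullet> p) = c \<bullet> subst s p"
  by (induction p rule: poly_mapping_additive_induct)
     (simp_all add: scale_add_right subst_add scale_single subst_single scale_scale)

lemma subst_sum: "subst s (sum f A) = (\<Sum>a\<in>A. subst s (f a))"
  by (induction A rule: infinite_finite_induct) (simp_all add: subst_add)

lemma subst_mult: "subst s (p * q) = subst s p * subst s q"
proof (induction p rule: poly_mapping_additive_induct)
  case (single w c)
  show ?case
    by (induction q rule: poly_mapping_additive_induct)
       (simp_all add: subst_add algebra_simps mult_single subst_single plus_word_def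
          mult_scale_left mult_scale_right scale_scale)
qed (simp_all add: subst_add algebra_simps)

definition var :: "'g \<Rightarrow> ('g, 'k::field) free_alg"
  where "var i = Poly_Mapping.single (Word [i]) 1"

lemma subst_var [simp]: "subst s (var i) = s i"
  by (simp add: var_def subst_single)

lemma subst_var_id: "subst var p = p"
proof (induction p rule: poly_mapping_additive_induct)
  case (single w c)
  have "prod_list (map var xs) = (Poly_Mapping.single (Word xs) 1 :: ('a, 'b) free_alg)" for xs
    by (induction xs) (simp_all add: var_def mult_single plus_word_def flip: zero_word_def)
  then show ?case
    by (simp add: subst_single scale_single)
qed (simp_all add: subst_add)

lemma subst_subst: "subst t (subst s p) = subst (\<lambda>i. subst t (s i)) p"
proof (induction p rule: poly_mapping_additive_induct)
  case (single w c)
  have "subst t (prod_list (map s xs)) = prod_list (map (\<lambda>i. subst t (s i)) xs)" for xs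
    by (induction xs) (simp_all add: subst_mult)
  then show ?case
    by (simp add: subst_single subst_scale)
qed (simp_all add: subst_add)


section \<open>Isomorphisms of quotients of free algebras\<close>

text \<open>Membership in such an ideal is expressed below in terms of the type class operations on
\<^typ>\<open>('g, 'k) free_alg\<close>, so that the simplifier's algebra applies instead of carrier-based reasoning.\<close>

definition ideal_of :: "('g, 'k::field) free_alg set \<Rightarrow> ('g, 'k) free_alg set"
  where "ideal_of R = Idl\<^bsub>free_algebra\<^esub> R"

abbreviation quot_by :: "('g, 'k::field) free_alg set \<Rightarrow> ('k, ('g, 'k) free_alg set) module"
  where "quot_by R \<equiv> quot_algebra free_algebra (ideal_of R)"

lemma free_algebra_simps [simp]:
  "carrier free_algebra = UNIV" "p \<otimes>\<^bsub>free_algebra\<^esub> q = p * q" "\<one>\<^bsub>free_algebra\<^esub> = 1"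
  "\<zero>\<^bsub>free_algebra\<^esub> = 0" "p \<oplus>\<^bsub>free_algebra\<^esub> q = p + q" "c \<odot>\<^bsub>free_algebra\<^esub> p = c \<bullet> p"
  by (simp_all add: free_algebra_def)

lemma a_inv_free_algebra [simp]: "\<ominus>\<^bsub>free_algebra\<^esub> p = - p"
proof -
  interpret ring free_algebra by (rule ring_free_algebra)
  show ?thesis
    using minus_equality[of "- p" p] by simp
qed

lemma minus_free_algebra [simp]: "p \<ominus>\<^bsub>free_algebra\<^esub> q = p - q"
  by (simp add: a_minus_def)

lemma ideal_free_algebraI:
  assumes "0 \<in> I" "\<And>p q. p \<in> I \<Longrightarrow> q \<in> I \<Longrightarrow> p + q \<in> I"
    and "\<And>p q. p \<in> I \<Longrightarrow> q * p \<in> I" "\<And>p q. p \<in> I \<Longrightarrow> p * q \<in> I"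
  shows "ideal I (free_algebra :: ('k::field, ('g, 'k) free_alg) module)"
proof (rule idealI[OF ring_free_algebra])
  show "subgroup I (add_monoid (free_algebra :: ('k, ('g, 'k) free_alg) module))"
  proof
    fix p assume "p \<in> I"
    then show "inv\<^bsub>add_monoid free_algebra\<^esub> p \<in> I"
      using assms(3)[of p "- 1"] a_inv_free_algebra[of p] unfolding a_inv_def by simp
  qed (use assms in auto)
qed (use assms in auto)

lemma ideal_ideal_of: "ideal (ideal_of R) free_algebra"
  unfolding ideal_of_def by (rule ring.genideal_ideal[OF ring_free_algebra]) simp

lemma ideal_of_superset: "R \<subseteq> ideal_of R"
  unfolding ideal_of_def by (rule ring.genideal_self[OF ring_free_algebra]) simp

lemma ideal_of_minimal: "ideal I free_algebra \<Longrightarrow> R \<subseteq> I \<Longrightarrow> ideal_of R \<subseteq> I"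
  unfolding ideal_of_def by (rule ring.genideal_minimal[OF ring_free_algebra])

lemma ideal_of_closed:
  shows "0 \<in> ideal_of R"
    and "p \<in> ideal_of R \<Longrightarrow> q \<in> ideal_of R \<Longrightarrow> p + q \<in> ideal_of R"
    and "p \<in> ideal_of R \<Longrightarrow> q * p \<in> ideal_of R"
    and "p \<in> ideal_of R \<Longrightarrow> p * q \<in> ideal_of R"
    and "p \<in> ideal_of R \<Longrightarrow> c \<bullet> p \<in> ideal_of R"
proof -
  interpret ideal "ideal_of R" free_algebra by (rule ideal_ideal_of)
  have "additive_subgroup (ideal_of R) free_algebra" ..
  from additive_subgroup.zero_closed[OF this] additive_subgroup.a_closed[OF this, of p q]
  show "0 \<in> ideal_of R"
    and "p \<in> ideal_of R \<Longrightarrow> q \<in> ideal_of R \<Longrightarrow> p + q \<in> ideal_of R" by simp_all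
  show "p \<in> ideal_of R \<Longrightarrow> q * p \<in> ideal_of R" for q using I_l_closed[of p q] by simp
  show "p \<in> ideal_of R \<Longrightarrow> p * q \<in> ideal_of R" using I_r_closed[of p q] by simp
  show "p \<in> ideal_of R \<Longrightarrow> c \<bullet> p \<in> ideal_of R"
    using I_l_closed[of p "Poly_Mapping.single 0 c"] by (simp add: scale_conv_mult)
qed

abbreviation coset :: "('g, 'k::field) free_alg set \<Rightarrow> ('g, 'k) free_alg \<Rightarrow> ('g, 'k) free_alg set"
  where "coset R p \<equiv> ideal_of R +>\<^bsub>free_algebra\<^esub> p"

lemma coset_eq_iff: "coset R p = coset R q \<longleftrightarrow> p - q \<in> ideal_of R"
  using ring.quotient_eq_iff_same_a_r_cos[OF ring_free_algebra ideal_ideal_of, of p q R] by simp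

lemma carrier_quot_by: "carrier (quot_by R) = range (coset R)"
  by (auto simp: carrier_quot_algebra A_RCOSETS_def')

lemma mult_coset: "coset R p \<otimes>\<^bsub>quot_by R\<^esub> coset R q = coset R (p * q)"
  using ideal.rcoset_mult_add[OF ideal_ideal_of, of p q R] by (simp add: mult_quot_algebra)

lemma add_coset: "coset R p \<oplus>\<^bsub>quot_by R\<^esub> coset R q = coset R (p + q)"
proof -
  interpret ideal "ideal_of R" free_algebra by (rule ideal_ideal_of)
  show ?thesis using a_rcos_sum[of p q] by (simp add: add_quot_algebra)
qed

lemma smult_coset: "c \<odot>\<^bsub>quot_by R\<^esub> coset R p = coset R (c \<bullet> p)"
proof -
  interpret ideal "ideal_of R" free_algebra by (rule ideal_ideal_of)
  have const: "coset R (c \<bullet> a) = coset R (c \<bullet> p)" if "a \<in> coset R p" for a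
  proof -
    from that obtain i where "i \<in> ideal_of R" "a = i + p"
      by (auto simp: a_r_coset_def')
    then show ?thesis
      by (simp add: coset_eq_iff scale_add_right ideal_of_closed)
  qed
  have "p \<in> coset R p"
    using a_rcos_self[of p] by simp
  then show ?thesis
    unfolding smult_quot_algebra free_algebra_simps by (rule UN_constant_eq) (intro ballI const)
qed

lemma one_coset: "\<one>\<^bsub>quot_by R\<^esub> = coset R 1"
  by (simp add: one_quot_algebra)

lemma subst_ideal_of:
  assumes "\<And>r. r \<in> R \<Longrightarrow> subst s r \<in> ideal_of R'" and "p \<in> ideal_of R"
  shows "subst s p \<in> ideal_of R'"
proof -
  have "ideal {p. subst s p \<in> ideal_of R'} free_algebra"
    by (rule ideal_free_algebraI) (auto simp: subst_add subst_mult ideal_of_closed)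
  from ideal_of_minimal[OF this, of R] assms show ?thesis by auto
qed

text \<open>Two substitutions that respect the relations and are inverse to each other on the generators induce
inverse maps of the quotients.\<close>

lemma algebra_isomorphic_quot_byI:
  assumes st: "\<And>r. r \<in> R \<Longrightarrow> subst s r \<in> ideal_of R'" "\<And>r. r \<in> R' \<Longrightarrow> subst t r \<in> ideal_of R"
    and inv: "\<And>i. subst s (t i) = var i" "\<And>i. subst t (s i) = var i"
  shows "quot_by R \<cong>\<^sub>a\<^sub>l\<^sub>g quot_by R'"
proof -
  have s: "subst s p \<in> ideal_of R' \<longleftrightarrow> p \<in> ideal_of R" for p
    using subst_ideal_of[OF st(1), where p = p] subst_ideal_of[OF st(2), where p = "subst s p"]
    by (auto simp: subst_subst inv subst_var_id)
  \<comment> \<open>The induced map is defined on a coset by the choice of a representative.\<close>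
  define h where "h C = coset R' (subst s (SOME p. C = coset R p))" for C
  have h: "h (coset R p) = coset R' (subst s p)" for p
  proof -
    have "coset R p = coset R (SOME q. coset R p = coset R q)"
      by (rule someI) (rule refl)
    then have "coset R (SOME q. coset R p = coset R q) = coset R p"
      by (rule sym)
    then show ?thesis
      by (simp add: h_def coset_eq_iff s flip: subst_diff)
  qed
  have "h \<in> ring_hom (quot_by R) (quot_by R')"
    by (rule ring_hom_memI)
       (auto simp: carrier_quot_by h mult_coset add_coset one_coset subst_mult subst_add)
  moreover have "bij_betw h (carrier (quot_by R)) (carrier (quot_by R'))"
  proof (rule bij_betw_imageI)
    show "inj_on h (carrier (quot_by R))"
      by (auto simp: inj_on_def carrier_quot_by h coset_eq_iff s simp flip: subst_diff)
    have "coset R' p \<in> h ` range (coset R)" for p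
      by (rule image_eqI[of _ _ "coset R (subst t p)"])
         (simp_all add: h subst_subst inv subst_var_id)
    then show "h ` carrier (quot_by R) = carrier (quot_by R')"
      by (auto simp: carrier_quot_by h)
  qed
  moreover have "\<forall>c. \<forall>C\<in>carrier (quot_by R). h (c \<odot>\<^bsub>quot_by R\<^esub> C) = c \<odot>\<^bsub>quot_by R'\<^esub> h C"
    by (auto simp: carrier_quot_by h smult_coset subst_scale)
  ultimately show ?thesis
    by (auto simp: algebra_isomorphic_def algebra_iso_def ring_iso_def)
qed

text \<open>Conversely, any homomorphism out of a quotient is induced by a substitution: lift the images of the
generators.\<close>

lemma algebra_iso_quot_byD:
  assumes "h \<in> algebra_iso (quot_by R) (quot_by R')"
  obtains s where "\<And>p. h (coset R p) = coset R' (subst s p)"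
proof -
  have hom: "h \<in> ring_hom (quot_by R) (quot_by R')"
    and sm: "h (c \<odot>\<^bsub>quot_by R\<^esub> coset R p) = c \<odot>\<^bsub>quot_by R'\<^esub> h (coset R p)" for c p
    using assms by (auto simp: algebra_iso_def ring_iso_def carrier_quot_by)
  have "\<exists>q. h (coset R (var i)) = coset R' q" for i
    using ring_hom_closed[OF hom, of "coset R (var i)"] by (auto simp: carrier_quot_by)
  then obtain s where s: "\<And>i. h (coset R (var i)) = coset R' (s i)"
    by metis
  have hadd: "h (coset R (p + q)) = h (coset R p) \<oplus>\<^bsub>quot_by R'\<^esub> h (coset R q)" for p q
    using ring_hom_add[OF hom, of "coset R p" "coset R q"] by (simp add: carrier_quot_by add_coset)
  have hmult: "h (coset R (p * q)) = h (coset R p) \<otimes>\<^bsub>quot_by R'\<^esub> h (coset R q)" for p q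
    using ring_hom_mult[OF hom, of "coset R p" "coset R q"] by (simp add: carrier_quot_by mult_coset)
  have h1: "h (coset R 1) = coset R' 1"
    using ring_hom_one[OF hom] by (simp add: one_coset)
  have hscale: "h (coset R (c \<bullet> p)) = c \<odot>\<^bsub>quot_by R'\<^esub> h (coset R p)" for c p
    using sm by (simp add: smult_coset)
  have word: "h (coset R (Poly_Mapping.single (Word xs) 1)) = coset R' (prod_list (map s xs))" for xs
  proof (induction xs)
    case Nil
    then show ?case using h1 by (simp flip: zero_word_def)
  next
    case (Cons x xs)
    have "h (coset R (Poly_Mapping.single (Word (x # xs)) 1)) =
        h (coset R (var x * Poly_Mapping.single (Word xs) 1))"
      by (simp add: var_def mult_single plus_word_def)
    then show ?case by (simp add: hmult Cons s mult_coset)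
  qed
  have "h (coset R p) = coset R' (subst s p)" for p
  proof (induction p rule: poly_mapping_additive_induct)
    case zero
    show ?case using hscale[of 0 0] word[of "[]"] hscale[of 0 1] h1
      by (simp add: smult_coset scale_conv_mult)
  next
    case (single w c)
    then show ?case
      using hscale[of c "Poly_Mapping.single w 1"] word[of "letters w"]
      by (simp add: scale_single subst_single smult_coset)
  qed (simp add: hadd add_coset subst_add)
  then show ?thesis by (rule that)
qed


text \<open>Lifting an isomorphism and its inverse gives two substitutions that are mutually inverse modulo the
relations. The inverse is lifted only on the generators, through surjectivity of the isomorphism;
injectivity then shows that the lift respects the relations.\<close>

lemma algebra_isomorphic_quot_byD:
  assumes "quot_by R \<cong>\<^sub>a\<^sub>l\<^sub>g quot_by R'"
  obtains s t where
    "\<And>p. p \<in> ideal_of R \<Longrightarrow> subst s p \<in> ideal_of R'"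
    "\<And>p. p \<in> ideal_of R' \<Longrightarrow> subst t p \<in> ideal_of R"
    "\<And>p. subst t (subst s p) - p \<in> ideal_of R"
    "\<And>p. subst s (subst t p) - p \<in> ideal_of R'"
proof -
  obtain h where h: "h \<in> algebra_iso (quot_by R) (quot_by R')"
    using assms by (auto simp: algebra_isomorphic_def)
  obtain s where s: "\<And>p. h (coset R p) = coset R' (subst s p)"
    by (rule algebra_iso_quot_byD[OF h]) (rule that)
  have bij: "bij_betw h (range (coset R)) (range (coset R'))"
    using h by (auto simp: algebra_iso_def ring_iso_def carrier_quot_by)
  have s_iff: "subst s p \<in> ideal_of R' \<longleftrightarrow> p \<in> ideal_of R" for p
  proof -
    have "h (coset R p) = h (coset R 0) \<longleftrightarrow> coset R p = coset R 0"
      using bij by (auto simp: bij_betw_def inj_on_def)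
    then show ?thesis by (simp add: s coset_eq_iff)
  qed
  have "\<exists>q. subst s q - var i \<in> ideal_of R'" for i
  proof -
    have "coset R' (var i) \<in> h ` range (coset R)"
      using bij by (simp add: bij_betw_def)
    then obtain q where "coset R' (var i) = h (coset R q)" by auto
    then have "h (coset R q) = coset R' (var i)" by (rule sym)
    then show ?thesis by (auto simp: s coset_eq_iff)
  qed
  then obtain t where t: "\<And>i. subst s (t i) - var i \<in> ideal_of R'"
    by metis
  have st: "subst s (subst t p) - p \<in> ideal_of R'" for p
  proof (induction p rule: poly_mapping_additive_induct)
    case (single w c)
    have "subst s (prod_list (map t xs)) - prod_list (map var xs) \<in> ideal_of R'" for xs
    proof (induction xs)
      case (Cons x xs)
      have "subst s (prod_list (map t (x # xs))) - prod_list (map var (x # xs)) =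
          subst s (t x) * (subst s (prod_list (map t xs)) - prod_list (map var xs)) +
          (subst s (t x) - var x) * prod_list (map var xs)"
        by (simp add: subst_mult algebra_simps)
      with Cons t[of x] show ?case by (simp add: ideal_of_closed)
    qed (simp add: ideal_of_closed)
    from ideal_of_closed(5)[OF this[of "letters w"], of c]
    have "subst s (subst t (Poly_Mapping.single w c)) - subst var (Poly_Mapping.single w c)
        \<in> ideal_of R'"
      by (simp add: subst_single subst_scale) (simp add: scale_conv_mult algebra_simps)
    then show ?case by (simp add: subst_var_id)
  next
    case (add p q)
    from ideal_of_closed(2)[OF this] show ?case by (simp add: subst_add algebra_simps)
  qed (simp add: ideal_of_closed)
  have "subst t p \<in> ideal_of R" if "p \<in> ideal_of R'" for p
  proof -
    have "subst s (subst t p) \<in> ideal_of R'"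
      using ideal_of_closed(2)[OF st[of p] that] by simp
    then show ?thesis by (simp add: s_iff)
  qed
  moreover have "subst t (subst s p) - p \<in> ideal_of R" for p
    using st[of "subst s p"] by (simp add: s_iff flip: subst_diff)
  ultimately show ?thesis using that st s_iff by blast
qed


section \<open>Quadratic algebras\<close>

lemma lookup_mult_word:
  fixes p q :: "('g, 'k::field) free_alg"
  shows "Poly_Mapping.lookup (p * q) (Word xs) =
    (\<Sum>k\<le>length xs. Poly_Mapping.lookup p (Word (take k xs)) * Poly_Mapping.lookup q (Word (drop k xs)))"
proof (induction p rule: poly_mapping_additive_induct)
  case (single w c)
  show ?case
  proof (induction q rule: poly_mapping_additive_induct)
    case (single v d)
    obtain us vs where wv: "w = Word us" "v = Word vs" by (cases w, cases v)
    have split_iff: "us = take k xs \<and> vs = drop k xs \<longleftrightarrow> k = length us \<and> xs = us @ vs"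
      if "k \<le> length xs" for k
      using that by (metis append_eq_conv_conj append_take_drop_id length_take min.absorb2)
    have "(\<Sum>k\<le>length xs. Poly_Mapping.lookup (Poly_Mapping.single w c) (Word (take k xs)) *
          Poly_Mapping.lookup (Poly_Mapping.single v d) (Word (drop k xs))) =
        (\<Sum>k\<le>length xs. if k = length us then if xs = us @ vs then c * d else 0 else 0)"
    proof (intro sum.cong refl)
      fix k assume "k \<in> {..length xs}"
      then show "Poly_Mapping.lookup (Poly_Mapping.single w c) (Word (take k xs)) *
            Poly_Mapping.lookup (Poly_Mapping.single v d) (Word (drop k xs)) =
          (if k = length us then if xs = us @ vs then c * d else 0 else 0)"
        using split_iff[of k] unfolding wv lookup_single when_def word.inject atMost_iff
        by (cases "us = take k xs"; cases "vs = drop k xs"; simp)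
    qed
    also have "\<dots> = (if xs = us @ vs then c * d else 0)"
      by simp
    finally show ?case
      by (auto simp: wv mult_single lookup_single when_def plus_word_def)
  qed (simp_all add: lookup_add algebra_simps sum.distrib)
qed (simp_all add: lookup_add algebra_simps sum.distrib)

lemma lookup_mult_short:
  fixes p q :: "('g, 'k::field) free_alg"
  shows "Poly_Mapping.lookup (p * q) (Word []) =
      Poly_Mapping.lookup p (Word []) * Poly_Mapping.lookup q (Word [])"
    and "Poly_Mapping.lookup (p * q) (Word [i]) =
      Poly_Mapping.lookup p (Word []) * Poly_Mapping.lookup q (Word [i]) +
      Poly_Mapping.lookup p (Word [i]) * Poly_Mapping.lookup q (Word [])"
    and "Poly_Mapping.lookup (p * q) (Word [i, j]) =
      Poly_Mapping.lookup p (Word []) * Poly_Mapping.lookup q (Word [i, j]) +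
      Poly_Mapping.lookup p (Word [i]) * Poly_Mapping.lookup q (Word [j]) +
      Poly_Mapping.lookup p (Word [i, j]) * Poly_Mapping.lookup q (Word [])"
  by (simp_all add: lookup_mult_word numeral_2_eq_2)

lemma lookup_var [simp]:
  "Poly_Mapping.lookup (var i) (Word xs) = (if xs = [i] then 1 else 0)"
  by (auto simp: var_def lookup_single when_def)

text \<open>The linear and quadratic elements of the free algebra are encoded by their coefficients: a vector for
a linear form and a square matrix, read as a tensor in \<open>V \<otimes> V\<close>, for a quadratic element.\<close>

definition lin :: "'k ^ 'g \<Rightarrow> ('g::finite, 'k::field) free_alg"
  where "lin v = (\<Sum>i\<in>UNIV. v $ i \<bullet> var i)"

definition quad :: "'k ^ 'g ^ 'g \<Rightarrow> ('g::finite, 'k::field) free_alg"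
  where "quad b = (\<Sum>i\<in>UNIV. \<Sum>j\<in>UNIV. b $ i $ j \<bullet> (var i * var j))"

definition quad_part :: "('g::finite, 'k::field) free_alg \<Rightarrow> 'k ^ 'g ^ 'g"
  where "quad_part p = (\<chi> i j. Poly_Mapping.lookup p (Word [i, j]))"

lemma lookup_quad:
  fixes b :: "'k::field ^ 'g::finite ^ 'g"
  shows "Poly_Mapping.lookup (quad b) (Word xs) =
     (if length xs = 2 then b $ (xs ! 0) $ (xs ! 1) else 0)"
proof -
  have vv: "var i * var j = (Poly_Mapping.single (Word [i, j]) 1 :: ('g, 'k) free_alg)"
    for i j
    by (simp add: var_def mult_single plus_word_def)
  have l: "Poly_Mapping.lookup (quad b) (Word xs) =
      (\<Sum>i\<in>UNIV. \<Sum>j\<in>UNIV. if [i, j] = xs then b $ i $ j else 0)"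
    unfolding quad_def lookup_sum lookup_scale vv lookup_single when_def
    by (intro sum.cong refl) auto
  show ?thesis
  proof (cases "length xs = 2")
    case True
    then obtain k l where xs: "xs = [k, l]"
      by (auto simp: length_Suc_conv numeral_2_eq_2)
    have "(\<Sum>i\<in>UNIV. \<Sum>j\<in>UNIV. if [i, j] = xs then b $ i $ j else 0) =
        (\<Sum>i\<in>UNIV. if i = k then \<Sum>j\<in>UNIV. if j = l then b $ i $ j else 0 else 0)"
      by (intro sum.cong refl) (auto simp: xs)
    also have "\<dots> = b $ k $ l" by simp
    finally show ?thesis unfolding l by (simp add: xs)
  qed (auto simp: l intro!: sum.neutral)
qed

lemma quad_part_quad [simp]: "quad_part (quad b) = b"
  by (simp add: quad_part_def lookup_quad vec_eq_iff)

lemma mat_mult_nth: "(mat c ** b) $ i $ j = c * b $ i $ j"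
  by (simp add: matrix_matrix_mult_def mat_def if_distrib[of "\<lambda>x. x * _"] cong: if_cong)

lemma quad_add: "quad (a + b) = quad a + quad b"
  and quad_scale: "quad (mat c ** b) = c \<bullet> quad b"
proof -
  have "Poly_Mapping.lookup (quad (mat c ** b)) w = Poly_Mapping.lookup (c \<bullet> quad b) w" for w
    by (cases w) (simp add: lookup_quad lookup_scale mat_mult_nth)
  moreover have "Poly_Mapping.lookup (quad (a + b)) w = Poly_Mapping.lookup (quad a + quad b) w" for w
    by (cases w) (simp add: lookup_quad lookup_add)
  ultimately show "quad (a + b) = quad a + quad b" "quad (mat c ** b) = c \<bullet> quad b"
    by (auto intro: poly_mapping_eqI)
qed

lemma homogeneous_2_eq_quad:
  assumes "homogeneous 2 f"
  shows "f = quad (quad_part f)"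
proof (rule poly_mapping_eqI)
  fix w :: "'a word"
  obtain xs where w: "w = Word xs" by (cases w)
  show "Poly_Mapping.lookup f w = Poly_Mapping.lookup (quad (quad_part f)) w"
  proof (cases "length xs = 2")
    case True
    then obtain k l where "xs = [k, l]"
      by (auto simp: length_Suc_conv numeral_2_eq_2)
    then show ?thesis by (simp add: w lookup_quad quad_part_def)
  next
    case False
    with assms have "Word xs \<notin> Poly_Mapping.keys f"
      by (auto simp: homogeneous_def)
    with False show ?thesis by (simp add: w lookup_quad in_keys_iff)
  qed
qed

text \<open>The action on quadratic elements of the linear substitution with matrix \<open>L\<close>: the tensor square of
\<open>L\<close> is matrix congruence.\<close>

definition congr :: "'k::field ^ 'g ^ 'g \<Rightarrow> 'k ^ 'g ^ 'g \<Rightarrow> 'k ^ 'g ^ ('g::finite)"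
  where "congr L b = transpose L ** b ** L"

lemma congr_nth:
  "congr L b $ k $ l = (\<Sum>i\<in>UNIV. \<Sum>j\<in>UNIV. b $ i $ j * (L $ i $ k * L $ j $ l))"
proof -
  have "congr L b $ k $ l = (\<Sum>j\<in>UNIV. \<Sum>i\<in>UNIV. b $ i $ j * (L $ i $ k * L $ j $ l))"
    by (simp add: congr_def matrix_matrix_mult_def transpose_def sum_distrib_right) (simp add: mult_ac)
  then show ?thesis by (subst sum.swap)
qed

lemma subst_lin_quad:
  fixes L :: "'k::field ^ 'g::finite ^ 'g"
  shows "subst (\<lambda>i. lin (L $ i)) (quad b) = quad (congr L b)"
proof -
  have lin_lin: "lin v * lin w = quad (\<chi> i j. v $ i * w $ j)" for v w :: "'k ^ 'g"
    unfolding lin_def quad_def sum_product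
    by (simp add: mult_scale_left mult_scale_right scale_scale mult.commute)
  have "subst (\<lambda>i. lin (L $ i)) (quad b) =
      (\<Sum>i\<in>UNIV. \<Sum>j\<in>UNIV. b $ i $ j \<bullet> quad (\<chi> k l. L $ i $ k * L $ j $ l))"
    by (subst quad_def) (simp add: subst_sum subst_scale subst_mult lin_lin)
  also have "\<dots> = quad (congr L b)"
  proof (rule poly_mapping_eqI)
    fix w :: "'g word"
    show "Poly_Mapping.lookup (\<Sum>i\<in>UNIV. \<Sum>j\<in>UNIV. b $ i $ j \<bullet> quad (\<chi> k l. L $ i $ k * L $ j $ l)) w =
        Poly_Mapping.lookup (quad (congr L b)) w"
      by (cases w) (simp add: lookup_sum lookup_scale lookup_quad congr_nth)
  qed
  finally show ?thesis .
qed

lemma subst_lin_lin: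
  fixes A B :: "'k::field ^ 'g::finite ^ 'g"
  assumes "A ** B = mat 1"
  shows "subst (\<lambda>i. lin (B $ i)) (lin (A $ i)) = var i"
proof (rule poly_mapping_eqI)
  fix w
  have "(A ** B) $ i $ j = (if i = j then 1 else 0)" for j
    using assms by (simp add: mat_def)
  then have AB: "(\<Sum>k\<in>UNIV. A $ i $ k * B $ k $ j) = (if i = j then 1 else 0)" for j
    by (simp add: matrix_matrix_mult_def)
  have "subst (\<lambda>i. lin (B $ i)) (lin (A $ i)) =
      (\<Sum>k\<in>UNIV. \<Sum>j\<in>UNIV. (A $ i $ k * B $ k $ j) \<bullet> var j)"
    by (simp add: lin_def subst_sum subst_scale scale_sum scale_scale)
  also have "\<dots> = (\<Sum>j\<in>UNIV. \<Sum>k\<in>UNIV. (A $ i $ k * B $ k $ j) \<bullet> var j)"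
    by (rule sum.swap)
  finally have "Poly_Mapping.lookup (subst (\<lambda>i. lin (B $ i)) (lin (A $ i))) w =
      (\<Sum>j\<in>UNIV. (\<Sum>k\<in>UNIV. A $ i $ k * B $ k $ j) * Poly_Mapping.lookup (var j) w)"
    by (simp add: lookup_sum lookup_scale sum_distrib_right)
  also have "\<dots> = (\<Sum>j\<in>UNIV. if i = j then Poly_Mapping.lookup (var j) w else 0)"
    by (intro sum.cong refl) (simp add: AB)
  finally show "Poly_Mapping.lookup (subst (\<lambda>i. lin (B $ i)) (lin (A $ i))) w =
      Poly_Mapping.lookup (var i) w"
    by simp
qed

text \<open>The easy half of the criterion: a linear change of variables that carries one space of relations onto
the other is an isomorphism of the algebras.\<close>

theorem quadratic_algebra_isomorphicI:
  fixes L :: "'k::field ^ 'g::finite ^ 'g"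
  assumes "invertible L" and img: "congr L ` T = T'"
  shows "quot_by (quad ` T) \<cong>\<^sub>a\<^sub>l\<^sub>g quot_by (quad ` T')"
proof -
  obtain M where M: "L ** M = mat 1" "M ** L = mat 1"
    using assms(1) by (auto simp: invertible_def)
  have inv: "congr M (congr L b) = b" for b
  proof -
    have "congr M (congr L b) = transpose (L ** M) ** b ** (L ** M)"
      by (simp add: congr_def matrix_transpose_mul matrix_mul_assoc)
    then show ?thesis by (simp add: M)
  qed
  show ?thesis
  proof (rule algebra_isomorphic_quot_byI)
    show "subst (\<lambda>i. lin (L $ i)) r \<in> ideal_of (quad ` T')" if "r \<in> quad ` T" for r
      using that img ideal_of_superset by (fastforce simp: subst_lin_quad)
    show "subst (\<lambda>i. lin (M $ i)) r \<in> ideal_of (quad ` T)" if "r \<in> quad ` T'" for r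
      using that ideal_of_superset by (fastforce simp: subst_lin_quad inv simp flip: img)
  qed (simp_all add: subst_lin_lin M)
qed

definition matrix_subspace :: "('k::field ^ 'g ^ 'g::finite) set \<Rightarrow> bool"
  where "matrix_subspace T \<longleftrightarrow>
    0 \<in> T \<and> (\<forall>a\<in>T. \<forall>b\<in>T. a + b \<in> T) \<and> (\<forall>a\<in>T. \<forall>c. mat c ** a \<in> T)"

text \<open>In degree at most two, an ideal generated by a space of quadratic elements contains nothing besides
that space: multiplying a relation by an element with constant term \<open>c\<close> changes its quadratic part
by the factor \<open>c\<close>, and contributes otherwise only in degree three and higher. This holds for the two-sided ideal
because the elements with this property form one.\<close>

lemma ideal_of_quad_low_degree:
  fixes T :: "('k::field ^ 'g ^ 'g::finite) set"
  assumes T: "matrix_subspace T" and p: "p \<in> ideal_of (quad ` T)"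
  shows "Poly_Mapping.lookup p (Word []) = 0" "Poly_Mapping.lookup p (Word [i]) = 0"
    and "quad_part p \<in> T"
proof -
  let ?I = "{p. Poly_Mapping.lookup p (Word []) = 0 \<and> (\<forall>i. Poly_Mapping.lookup p (Word [i]) = 0) \<and>
      quad_part p \<in> T}"
  have mult: "quad_part (q * p) = mat (Poly_Mapping.lookup q (Word [])) ** quad_part p"
      "quad_part (p * q) = mat (Poly_Mapping.lookup q (Word [])) ** quad_part p"
    if "Poly_Mapping.lookup p (Word []) = 0" "\<forall>i. Poly_Mapping.lookup p (Word [i]) = 0" for p q :: "('g, 'k) free_alg"
    using that by (simp_all add: vec_eq_iff mat_mult_nth quad_part_def lookup_mult_short)
  have add: "quad_part (p + q) = quad_part p + quad_part q" for p q :: "('g, 'k) free_alg"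
    by (simp add: quad_part_def vec_eq_iff lookup_add)
  have "ideal ?I free_algebra"
  proof (rule ideal_free_algebraI)
    have "quad_part (0 :: ('g, 'k) free_alg) = 0" by (simp add: quad_part_def vec_eq_iff)
    then show "0 \<in> ?I" using T by (simp add: matrix_subspace_def)
  qed (use T in \<open>auto simp: matrix_subspace_def mult add lookup_add lookup_mult_short\<close>)
  moreover have "quad ` T \<subseteq> ?I"
    by (auto simp: lookup_quad)
  ultimately have "ideal_of (quad ` T) \<subseteq> ?I" by (rule ideal_of_minimal)
  with p show "Poly_Mapping.lookup p (Word []) = 0" "Poly_Mapping.lookup p (Word [i]) = 0"
      "quad_part p \<in> T" by auto
qed

text \<open>The chain rule at first order. The coefficients \<open>d\<close> are the partial derivatives of \<open>p\<close> at the
constant terms of \<open>s\<close>; only their existence matters.\<close>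

lemma linear_part_subst:
  fixes p :: "('g::finite, 'k::field) free_alg" and s :: "'g \<Rightarrow> ('h, 'k) free_alg"
  shows "\<exists>d. \<forall>k. Poly_Mapping.lookup (subst s p) (Word [k]) =
    (\<Sum>j\<in>UNIV. d j * Poly_Mapping.lookup (s j) (Word [k]))"
proof (induction p rule: poly_mapping_additive_induct)
  case zero
  show ?case by (rule exI[of _ "\<lambda>_. 0"]) simp
next
  case (add p q)
  then obtain d e where
      "\<forall>k. Poly_Mapping.lookup (subst s p) (Word [k]) =
        (\<Sum>j\<in>UNIV. d j * Poly_Mapping.lookup (s j) (Word [k]))"
      "\<forall>k. Poly_Mapping.lookup (subst s q) (Word [k]) =
        (\<Sum>j\<in>UNIV. e j * Poly_Mapping.lookup (s j) (Word [k]))" by blast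
  then show ?case
    by (intro exI[of _ "\<lambda>j. d j + e j"])
       (simp add: subst_add lookup_add distrib_right sum.distrib)
next
  case (single w c)
  have "\<exists>d. \<forall>k. Poly_Mapping.lookup (prod_list (map s xs)) (Word [k]) =
      (\<Sum>j\<in>UNIV. d j * Poly_Mapping.lookup (s j) (Word [k]))" for xs
  proof (induction xs)
    case Nil
    have "(1 :: ('h, 'k) free_alg) = Poly_Mapping.single (Word []) 1"
      by (simp flip: zero_word_def)
    then have "Poly_Mapping.lookup (1 :: ('h, 'k) free_alg) (Word [k]) = 0" for k
      by (metis lookup_single_not_eq list.distinct(1) word.inject)
    then show ?case by (intro exI[of _ "\<lambda>_. 0"]) simp
  next
    case (Cons x xs)
    then obtain d where d: "\<forall>k. Poly_Mapping.lookup (prod_list (map s xs)) (Word [k]) =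
      (\<Sum>j\<in>UNIV. d j * Poly_Mapping.lookup (s j) (Word [k]))" by blast
    let ?a = "Poly_Mapping.lookup (s x) (Word [])"
    let ?b = "Poly_Mapping.lookup (prod_list (map s xs)) (Word [])"
    have "(\<Sum>j\<in>UNIV. (?a * d j + (if j = x then ?b else 0)) * Poly_Mapping.lookup (s j) (Word [k])) =
        ?a * (\<Sum>j\<in>UNIV. d j * Poly_Mapping.lookup (s j) (Word [k])) +
        (\<Sum>j\<in>UNIV. if j = x then ?b * Poly_Mapping.lookup (s j) (Word [k]) else 0)" for k
      unfolding sum_distrib_left sum.distrib[symmetric]
      by (intro sum.cong refl) (simp add: algebra_simps)
    then show ?case using d
      by (intro exI[of _ "\<lambda>j. ?a * d j + (if j = x then ?b else 0)"])
         (simp add: lookup_mult_short)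
  qed
  from this[of "letters w"] obtain d where d: "\<forall>k. Poly_Mapping.lookup (prod_list (map s (letters w))) (Word [k]) =
      (\<Sum>j\<in>UNIV. d j * Poly_Mapping.lookup (s j) (Word [k]))" by blast
  then show ?case
    by (intro exI[of _ "\<lambda>j. c * d j"])
       (simp add: subst_single lookup_scale sum_distrib_left mult.assoc)
qed

text \<open>The Jacobian matrix at the origin. The constant terms of \<open>s\<close> may be non-zero, so the isomorphisms
considered below need not preserve the augmentation ideal.\<close>

definition jacobian :: "('g \<Rightarrow> ('h, 'k::field) free_alg) \<Rightarrow> 'k ^ 'h::finite ^ 'g::finite"
  where "jacobian s = (\<chi> i j. Poly_Mapping.lookup (s i) (Word [j]))"

text \<open>Relations have no linear part, so an identity \<open>subst t (s i) = var i\<close> modulo relations is exact in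
degree one. By the chain rule the linear forms of \<open>t\<close> then span all linear forms.\<close>

lemma invertible_jacobian:
  fixes s t :: "'g::finite \<Rightarrow> ('g, 'k::field) free_alg"
  assumes T: "matrix_subspace T" and inv: "\<And>i. subst t (s i) - var i \<in> ideal_of (quad ` T)"
  shows "invertible (jacobian t)"
proof -
  have "Poly_Mapping.lookup (subst t (s i)) (Word [k]) = (if k = i then 1 else 0)" for i k
    using ideal_of_quad_low_degree(2)[OF T inv, of i k] by (simp add: lookup_minus split: if_splits)
  moreover have "\<forall>i. \<exists>d. \<forall>k. Poly_Mapping.lookup (subst t (s i)) (Word [k]) =
      (\<Sum>j\<in>UNIV. d j * Poly_Mapping.lookup (t j) (Word [k]))"
    by (intro allI linear_part_subst)
  from choice[OF this] obtain d where "\<And>i k. Poly_Mapping.lookup (subst t (s i)) (Word [k]) =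
      (\<Sum>j\<in>UNIV. d i j * Poly_Mapping.lookup (t j) (Word [k]))"
    by blast
  ultimately have "(\<chi> i j. d i j) ** jacobian t = mat 1"
    by (simp add: vec_eq_iff matrix_matrix_mult_def mat_def jacobian_def eq_commute)
  then show ?thesis
    unfolding invertible_left_inverse by blast
qed

text \<open>This is the reason why an ungraded isomorphism yields a graded one. Let \<open>c\<close> be the vector of constant
terms of \<open>s\<close>. The degree one part of \<open>subst s (quad b)\<close> is the derivative of \<open>b\<close> at \<open>c\<close>, applied to
the linear parts of \<open>s\<close>. It vanishes, and the linear parts are independent, so this derivative is zero
as a functional. But the same derivative governs the contribution of the quadratic parts of \<open>s\<close> to the
degree two part. Hence that part involves the linear parts only, and it is a relation.\<close>

lemma congr_jacobian_in:
  fixes s :: "'g::finite \<Rightarrow> ('g, 'k::field) free_alg"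
  assumes T: "matrix_subspace T'" and L: "invertible (jacobian s)"
    and s: "subst s (quad b) \<in> ideal_of (quad ` T')"
  shows "congr (jacobian s) b \<in> T'"
proof -
  define L where "L = jacobian s"
  define c where "c i = Poly_Mapping.lookup (s i) (Word [])" for i
  define u where "u = (\<chi> i. \<Sum>j\<in>UNIV. (b $ i $ j + b $ j $ i) * c j)"
  have lookup: "Poly_Mapping.lookup (subst s (quad b)) w =
      (\<Sum>i\<in>UNIV. \<Sum>j\<in>UNIV. b $ i $ j * Poly_Mapping.lookup (s i * s j) w)" for w
    by (simp add: quad_def subst_sum subst_scale subst_mult lookup_sum lookup_scale)
  \<comment> \<open>The derivative of the form \<open>b\<close> at the constant terms \<open>c\<close>, in direction \<open>a\<close>.\<close>
  have polar: "(\<Sum>i\<in>UNIV. \<Sum>j\<in>UNIV. b $ i $ j * (c i * a j + a i * c j)) = (\<Sum>i\<in>UNIV. u $ i * a i)"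
    for a
  proof -
    have "(\<Sum>i\<in>UNIV. \<Sum>j\<in>UNIV. b $ i $ j * (c i * a j + a i * c j)) =
        (\<Sum>i\<in>UNIV. \<Sum>j\<in>UNIV. b $ i $ j * c i * a j) + (\<Sum>i\<in>UNIV. \<Sum>j\<in>UNIV. b $ i $ j * c j * a i)"
      by (simp add: algebra_simps sum.distrib)
    also have "(\<Sum>i\<in>UNIV. \<Sum>j\<in>UNIV. b $ i $ j * c i * a j) =
        (\<Sum>i\<in>UNIV. \<Sum>j\<in>UNIV. b $ j $ i * c j * a i)"
      by (rule sum.swap)
    finally show ?thesis
      unfolding u_def vec_lambda_beta sum_distrib_right sum.distrib[symmetric] by (simp add: algebra_simps)
  qed
  have "(\<Sum>i\<in>UNIV. u $ i * L $ i $ k) = 0" for k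
    using ideal_of_quad_low_degree(2)[OF T s, of k] polar[of "\<lambda>i. L $ i $ k"]
    by (simp add: lookup lookup_mult_short L_def jacobian_def c_def)
  then have "u v* L = 0"
    by (simp add: vector_matrix_mult_def vec_eq_iff mult.commute)
  moreover obtain M where "L ** M = mat 1"
    using L by (auto simp: invertible_def L_def)
  ultimately have "u = 0"
    by (metis vector_matrix_mul_assoc vector_matrix_mul_rid vector_matrix_mult_0)
  have "quad_part (subst s (quad b)) = congr L b"
  proof -
    have "Poly_Mapping.lookup (subst s (quad b)) (Word [k, l]) = congr L b $ k $ l" for k l
    proof -
      have "Poly_Mapping.lookup (subst s (quad b)) (Word [k, l]) = congr L b $ k $ l +
          (\<Sum>i\<in>UNIV. \<Sum>j\<in>UNIV. b $ i $ j * (c i * Poly_Mapping.lookup (s j) (Word [k, l]) +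
            Poly_Mapping.lookup (s i) (Word [k, l]) * c j))"
        by (simp add: lookup lookup_mult_short L_def jacobian_def c_def congr_nth
            sum.distrib[symmetric] algebra_simps)
      then show ?thesis
        unfolding polar[of "\<lambda>i. Poly_Mapping.lookup (s i) (Word [k, l])"] by (simp add: \<open>u = 0\<close>)
    qed
    then show ?thesis by (simp add: quad_part_def vec_eq_iff)
  qed
  then show ?thesis
    using ideal_of_quad_low_degree(3)[OF T s] by (simp add: L_def)
qed

text \<open>Since the constant terms have dropped out, the Jacobian matrices of the two lifts map the relations of
each algebra into those of the other. The two matrices belong to different base points and need not be
inverse to each other; the inclusions in both directions are what the invariants below require.\<close>

theorem quadratic_algebra_isomorphicD:
  fixes T T' :: "('k::field ^ 'g ^ 'g::finite) set"
  assumes T: "matrix_subspace T" "matrix_subspace T'"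
    and iso: "quot_by (quad ` T) \<cong>\<^sub>a\<^sub>l\<^sub>g quot_by (quad ` T')"
  shows "\<exists>L. invertible L \<and> congr L ` T \<subseteq> T'" "\<exists>L. invertible L \<and> congr L ` T' \<subseteq> T"
proof -
  obtain s t where st:
    "\<And>p. p \<in> ideal_of (quad ` T) \<Longrightarrow> subst s p \<in> ideal_of (quad ` T')"
    "\<And>p. p \<in> ideal_of (quad ` T') \<Longrightarrow> subst t p \<in> ideal_of (quad ` T)"
    "\<And>p. subst t (subst s p) - p \<in> ideal_of (quad ` T)"
    "\<And>p. subst s (subst t p) - p \<in> ideal_of (quad ` T')"
    using algebra_isomorphic_quot_byD[OF iso] by metis
  have t: "invertible (jacobian t)"
    using st(3)[of "var _"] by (intro invertible_jacobian[OF T(1), of t s]) simp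
  have s: "invertible (jacobian s)"
    using st(4)[of "var _"] by (intro invertible_jacobian[OF T(2), of s t]) simp
  have mem: "quad b \<in> ideal_of (quad ` T)" if "b \<in> T" for b T
    using that ideal_of_superset by blast
  show "\<exists>L. invertible L \<and> congr L ` T \<subseteq> T'"
    using s congr_jacobian_in[OF T(2) s st(1)[OF mem]] by blast
  show "\<exists>L. invertible L \<and> congr L ` T' \<subseteq> T"
    using t congr_jacobian_in[OF T(1) t st(2)[OF mem]] by blast
qed


section \<open>Algebras in three generators with a central generator\<close>

lemma UNIV_gen: "UNIV = {GX, GY, GZ}"
  using gen.exhaust by auto

instance gen :: finite
  by standard (simp add: UNIV_gen)

lemma sum_gen: "sum f UNIV = f GX + f GY + f GZ"
  by (simp add: UNIV_gen add.assoc)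

lemma forall_gen: "(\<forall>i. P i) \<longleftrightarrow> P GX \<and> P GY \<and> P GZ"
  by (metis gen.exhaust)

lemma det_gen:
  fixes A :: "'k::comm_ring_1 ^ gen ^ gen"
  shows "det A =
    A $ GX $ GX * A $ GY $ GY * A $ GZ $ GZ + A $ GX $ GY * A $ GY $ GZ * A $ GZ $ GX +
    A $ GX $ GZ * A $ GY $ GX * A $ GZ $ GY - A $ GX $ GX * A $ GY $ GZ * A $ GZ $ GY -
    A $ GX $ GY * A $ GY $ GX * A $ GZ $ GZ - A $ GX $ GZ * A $ GY $ GY * A $ GZ $ GX"
proof -
  have f: "finite {GY, GZ}" "GX \<notin> {GY, GZ}" "finite {GZ}" "GY \<notin> {GZ}" by auto
  show ?thesis
    unfolding det_def UNIV_gen sum_over_permutations_insert[OF f(1,2)]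
      sum_over_permutations_insert[OF f(3,4)] permutes_sing
    by (simp add: sign_swap_id sign_compose permutation_swap_id swap_id_eq algebra_simps)
qed

definition mat9 :: "'k \<Rightarrow> 'k \<Rightarrow> 'k \<Rightarrow> 'k \<Rightarrow> 'k \<Rightarrow> 'k \<Rightarrow> 'k \<Rightarrow> 'k \<Rightarrow> 'k \<Rightarrow> 'k ^ gen ^ gen"
  where "mat9 a b c d e f g h i = (\<chi> r s. case r of
    GX \<Rightarrow> (case s of GX \<Rightarrow> a | GY \<Rightarrow> b | GZ \<Rightarrow> c)
  | GY \<Rightarrow> (case s of GX \<Rightarrow> d | GY \<Rightarrow> e | GZ \<Rightarrow> f)
  | GZ \<Rightarrow> (case s of GX \<Rightarrow> g | GY \<Rightarrow> h | GZ \<Rightarrow> i))"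

lemma mat9_nth [simp]:
  "mat9 a b c d e f g h i $ GX $ GX = a" "mat9 a b c d e f g h i $ GX $ GY = b"
  "mat9 a b c d e f g h i $ GX $ GZ = c" "mat9 a b c d e f g h i $ GY $ GX = d"
  "mat9 a b c d e f g h i $ GY $ GY = e" "mat9 a b c d e f g h i $ GY $ GZ = f"
  "mat9 a b c d e f g h i $ GZ $ GX = g" "mat9 a b c d e f g h i $ GZ $ GY = h"
  "mat9 a b c d e f g h i $ GZ $ GZ = i"
  by (simp_all add: mat9_def)

definition commX :: "'k::field ^ gen ^ gen" where "commX = mat9 0 0 1 0 0 0 (-1) 0 0"
definition commY :: "'k::field ^ gen ^ gen" where "commY = mat9 0 0 0 0 0 1 0 (-1) 0"

text \<open>Relators that differ by a non-zero factor and by commutators with \<open>z\<close> define the same algebra; passing to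
the span of all three relations removes this ambiguity.\<close>

definition rel_space :: "'k::field ^ gen ^ gen \<Rightarrow> ('k ^ gen ^ gen) set"
  where "rel_space b = {mat r ** commX + mat s ** commY + mat t ** b | r s t. True}"

lemma rel_spaceI: "A = mat r ** commX + mat s ** commY + mat t ** b \<Longrightarrow> A \<in> rel_space b"
  by (auto simp: rel_space_def)

lemma matrix_subspace_rel_space: "matrix_subspace (rel_space b)"
proof -
  have "0 \<in> rel_space b"
    by (rule rel_spaceI[of _ 0 0 0]) (simp add: vec_eq_iff mat_mult_nth)
  moreover have "A + B \<in> rel_space b" if "A \<in> rel_space b" "B \<in> rel_space b" for A B
  proof -
    from that obtain r s t r' s' t' where
        "A = mat r ** commX + mat s ** commY + mat t ** b"
        "B = mat r' ** commX + mat s' ** commY + mat t' ** b"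
      by (auto simp: rel_space_def)
    then show ?thesis
      by (intro rel_spaceI[of _ "r + r'" "s + s'" "t + t'"])
         (simp add: vec_eq_iff mat_mult_nth algebra_simps)
  qed
  moreover have "mat c ** A \<in> rel_space b" if "A \<in> rel_space b" for c A
  proof -
    from that obtain r s t where "A = mat r ** commX + mat s ** commY + mat t ** b"
      by (auto simp: rel_space_def)
    then show ?thesis
      by (intro rel_spaceI[of _ "c * r" "c * s" "c * t"])
         (simp add: vec_eq_iff mat_mult_nth algebra_simps)
  qed
  ultimately show ?thesis by (simp add: matrix_subspace_def)
qed

lemma XYZ_eq_var: "X = var GX" "Y = var GY" "Z = var GZ"
  by (simp_all add: X_def Y_def Z_def var_def)

lemma quad_mat9: "quad (mat9 a b c d e f g h i) =
   a \<bullet> (X * X) + b \<bullet> (X * Y) + c \<bullet> (X * Z) + d \<bullet> (Y * X) + e \<bullet> (Y * Y) + f \<bullet> (Y * Z) +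
   g \<bullet> (Z * X) + h \<bullet> (Z * Y) + i \<bullet> (Z * Z)"
  by (simp add: quad_def sum_gen XYZ_eq_var add.assoc)

lemma H_quad: "H (quad b) = quot_by (quad ` rel_space b)"
proof -
  have c: "quad commX = X * Z - Z * X" "quad commY = Y * Z - Z * Y"
    by (simp_all add: commX_def commY_def quad_mat9)
  have "quad ` rel_space b \<subseteq> ideal_of {X * Z - Z * X, Y * Z - Z * Y, quad b}"
    using ideal_of_superset[of "{X * Z - Z * X, Y * Z - Z * Y, quad b}"]
    by (auto simp: rel_space_def quad_add quad_scale c intro!: ideal_of_closed)
  moreover have "{X * Z - Z * X, Y * Z - Z * Y, quad b} \<subseteq> ideal_of (quad ` rel_space b)"
  proof -
    have "commX \<in> rel_space b"
      by (rule rel_spaceI[of _ 1 0 0]) (simp add: vec_eq_iff mat_mult_nth)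
    moreover have "commY \<in> rel_space b"
      by (rule rel_spaceI[of _ 0 1 0]) (simp add: vec_eq_iff mat_mult_nth)
    moreover have "b \<in> rel_space b"
      by (rule rel_spaceI[of _ 0 0 1]) (simp add: vec_eq_iff mat_mult_nth)
    ultimately have "quad ` {commX, commY, b} \<subseteq> quad ` rel_space b" by blast
    then show ?thesis using ideal_of_superset[of "quad ` rel_space b"] by (auto simp: c)
  qed
  ultimately have "ideal_of {X * Z - Z * X, Y * Z - Z * Y, quad b} = ideal_of (quad ` rel_space b)"
    by (intro equalityI ideal_of_minimal ideal_ideal_of)
  then show ?thesis
    unfolding H_def ideal_of_def[symmetric] by simp
qed

text \<open>Modulo the commutators with \<open>z\<close>, a relator can be written with \<open>z\<close> to the right: a quadratic form
\<open>\<alpha>xx + \<beta>xy + \<gamma>yx + \<delta>yy\<close>, a linear form \<open>uxz + vyz\<close> and a term \<open>wzz\<close>.\<close>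

abbreviation form :: "'k::field \<Rightarrow> 'k \<Rightarrow> 'k \<Rightarrow> 'k \<Rightarrow> 'k \<Rightarrow> 'k \<Rightarrow> 'k \<Rightarrow> 'k ^ gen ^ gen"
  where "form \<alpha> \<beta> \<gamma> \<delta> u v w \<equiv> mat9 \<alpha> \<beta> u \<gamma> \<delta> v 0 0 w"

fun relator_matrix :: "'k::field name \<Rightarrow> 'k ^ gen ^ gen" where
  "relator_matrix (Quantum_plane q) = form 0 1 (-q) 0 0 0 0"
| "relator_matrix (Quantum_Weyl q) = form 0 1 (-q) 0 0 0 (-1)"
| "relator_matrix J = form 0 (-1) 1 1 0 0 0"
| "relator_matrix J1 = form 0 (-1) 1 1 0 0 1"
| "relator_matrix U = form 0 (-1) 1 0 0 1 0"
| "relator_matrix V = form 0 (-1) 1 1 1 0 0"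
| "relator_matrix R_x2 = form 1 0 0 0 0 0 0"
| "relator_matrix R_x2_minus_1 = form 1 0 0 0 0 0 (-1)"
| "relator_matrix R_yx = form 0 0 1 0 0 0 0"
| "relator_matrix S = form 0 0 1 0 0 0 (-1)"
| "relator_matrix Poly_x = form 1 0 0 0 0 1 0"

lemma relator_eq_quad: "relator n = quad (relator_matrix n)"
  by (cases n) (simp_all add: quad_mat9 power2_eq_square)

definition graded_equiv :: "'k::field ^ gen ^ gen \<Rightarrow> 'k ^ gen ^ gen \<Rightarrow> bool"
  where "graded_equiv b b' \<longleftrightarrow> (\<exists>L. invertible L \<and> congr L ` rel_space b = rel_space b')"

lemma graded_equiv_imp_isomorphic: "graded_equiv b b' \<Longrightarrow> H (quad b) \<cong>\<^sub>a\<^sub>l\<^sub>g H (quad b')"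
  unfolding H_quad graded_equiv_def using quadratic_algebra_isomorphicI by blast

lemma graded_equiv_trans:
  assumes "graded_equiv b b'" "graded_equiv b' b''"
  shows "graded_equiv b b''"
proof -
  obtain L M where LM: "invertible L" "congr L ` rel_space b = rel_space b'"
      "invertible M" "congr M ` rel_space b' = rel_space b''"
    using assms unfolding graded_equiv_def by blast
  have "congr M (congr L A) = congr (L ** M) A" for A
    by (simp add: congr_def matrix_transpose_mul matrix_mul_assoc)
  then have "congr (L ** M) ` rel_space b = rel_space b''"
    by (simp add: image_image flip: LM(2,4))
  with invertible_mult[OF LM(1,3)] show ?thesis
    unfolding graded_equiv_def by blast
qed

lemma congr_add: "congr L (A + B) = congr L A + congr L B"
  and congr_scale: "congr L (mat c ** A) = mat c ** congr L A"
  by (simp_all add: vec_eq_iff congr_nth mat_mult_nth sum.distrib sum_distrib_left algebra_simps)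

text \<open>The substitution is \<open>x \<mapsto> ax + by + ez\<close>, \<open>y \<mapsto> cx + dy + hz\<close>, \<open>z \<mapsto> lz\<close>.
It preserves the span of the commutators with \<open>z\<close>, so that only the seven coefficients of the relator
need to be compared, up to a common factor \<open>m\<close>. Each reduction step below is an instance.\<close>

lemma graded_equiv_form:
  fixes a b c d e h l m :: "'k::field"
  assumes det: "a * d - b * c \<noteq> 0" and l: "l \<noteq> 0" and m: "m \<noteq> 0"
    and xx: "\<alpha> * a * a + (\<beta> + \<gamma>) * a * c + \<delta> * c * c = m * \<alpha>'"
    and xy: "\<alpha> * a * b + \<beta> * a * d + \<gamma> * b * c + \<delta> * c * d = m * \<beta>'"
    and yx: "\<alpha> * a * b + \<beta> * b * c + \<gamma> * a * d + \<delta> * c * d = m * \<gamma>'"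
    and yy: "\<alpha> * b * b + (\<beta> + \<gamma>) * b * d + \<delta> * d * d = m * \<delta>'"
    and xz: "2 * \<alpha> * a * e + (\<beta> + \<gamma>) * (a * h + c * e) + 2 * \<delta> * c * h + l * (u * a + v * c) = m * u'"
    and yz: "2 * \<alpha> * b * e + (\<beta> + \<gamma>) * (b * h + d * e) + 2 * \<delta> * d * h + l * (u * b + v * d) = m * v'"
    and zz: "\<alpha> * e * e + (\<beta> + \<gamma>) * e * h + \<delta> * h * h + l * (u * e + v * h) + l * l * w = m * w'"
  shows "graded_equiv (form \<alpha> \<beta> \<gamma> \<delta> u v w) (form \<alpha>' \<beta>' \<gamma>' \<delta>' u' v' w')"
proof -
  define L where "L = mat9 a b e c d h 0 0 l"
  define B where "B = form \<alpha> \<beta> \<gamma> \<delta> u v w"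
  define B' where "B' = form \<alpha>' \<beta>' \<gamma>' \<delta>' u' v' w'"
  \<comment> \<open>Moving \<open>z\<close> to the right in the transformed relator costs these multiples of the commutators.\<close>
  define \<rho> where "\<rho> = - (congr L B $ GZ $ GX)"
  define \<sigma> where "\<sigma> = - (congr L B $ GZ $ GY)"
  have "det L = (a * d - b * c) * l"
    by (simp add: L_def det_gen algebra_simps)
  then have inv: "invertible L"
    using det l by (simp add: invertible_det_nz)
  have cX: "congr L commX = mat (l * a) ** commX + mat (l * b) ** commY"
    and cY: "congr L commY = mat (l * c) ** commX + mat (l * d) ** commY"
    by (simp_all add: vec_eq_iff forall_gen congr_nth mat_mult_nth sum_gen L_def commX_def commY_def
        algebra_simps)
  have cB: "congr L B = mat \<rho> ** commX + mat \<sigma> ** commY + mat m ** B'"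
    using xx xy yx yy xz yz zz
    by (simp add: vec_eq_iff forall_gen congr_nth mat_mult_nth sum_gen L_def B_def B'_def \<rho>_def \<sigma>_def
        commX_def commY_def algebra_simps)
  have cA: "congr L (mat r ** commX + mat s ** commY + mat t ** B) =
      mat (l * (a * r + c * s) + t * \<rho>) ** commX + mat (l * (b * r + d * s) + t * \<sigma>) ** commY +
      mat (t * m) ** B'" for r s t
    by (simp add: congr_add congr_scale cX cY cB)
       (simp add: vec_eq_iff mat_mult_nth algebra_simps)
  have "congr L ` rel_space B = rel_space B'"
  proof
    have "congr L A \<in> rel_space B'" if "A \<in> rel_space B" for A
    proof -
      from that obtain r s t where "A = mat r ** commX + mat s ** commY + mat t ** B"
        by (auto simp: rel_space_def)
      then show ?thesis by (simp only: cA) (rule rel_spaceI[OF refl])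
    qed
    then show "congr L ` rel_space B \<subseteq> rel_space B'" by blast
    show "rel_space B' \<subseteq> congr L ` rel_space B"
    proof
      fix A assume "A \<in> rel_space B'"
      then obtain r s t where A: "A = mat r ** commX + mat s ** commY + mat t ** B'"
        by (auto simp: rel_space_def)
      \<comment> \<open>Cramer's rule for the action on the span of the two commutators.\<close>
      define t' where "t' = t / m"
      define p where "p = (r - t' * \<rho>) / (l * (a * d - b * c))"
      define q where "q = (s - t' * \<sigma>) / (l * (a * d - b * c))"
      have p: "l * (a * d - b * c) * p = r - t' * \<rho>" and q: "l * (a * d - b * c) * q = s - t' * \<sigma>"
        using det l by (simp_all add: p_def q_def)
      have "congr L (mat (d * p - c * q) ** commX + mat (a * q - b * p) ** commY + mat t' ** B) =
          mat (l * (a * d - b * c) * p + t' * \<rho>) ** commX +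
          mat (l * (a * d - b * c) * q + t' * \<sigma>) ** commY + mat (t' * m) ** B'"
        unfolding cA by (simp add: algebra_simps)
      also have "\<dots> = A"
        unfolding p q A using m by (simp add: t'_def)
      finally show "A \<in> congr L ` rel_space B"
        by (intro image_eqI[OF sym]) (auto intro: rel_spaceI)
    qed
  qed
  with inv show ?thesis
    unfolding graded_equiv_def B_def B'_def by blast
qed

lemma graded_equiv_refl: "graded_equiv b b"
proof -
  have "congr (mat 1) A = A" for A :: "'a ^ gen ^ gen"
    by (simp add: congr_def)
  then have "congr (mat 1) ` rel_space b = rel_space b" by simp
  moreover have "invertible (mat 1 :: 'a ^ gen ^ gen)"
    by (simp add: invertible_det_nz)
  ultimately show ?thesis unfolding graded_equiv_def by blast
qed

lemma rel_space_form:
  "rel_space b = rel_space (form (b $ GX $ GX) (b $ GX $ GY) (b $ GY $ GX) (b $ GY $ GY)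
     (b $ GX $ GZ + b $ GZ $ GX) (b $ GY $ GZ + b $ GZ $ GY) (b $ GZ $ GZ))" (is "_ = rel_space ?c")
proof -
  have "mat r ** commX + mat s ** commY + mat t ** b =
      mat (r - t * b $ GZ $ GX) ** commX + mat (s - t * b $ GZ $ GY) ** commY + mat t ** ?c" for r s t
    by (simp add: vec_eq_iff forall_gen mat_mult_nth commX_def commY_def algebra_simps)
  moreover have "mat r ** commX + mat s ** commY + mat t ** ?c =
      mat (r + t * b $ GZ $ GX) ** commX + mat (s + t * b $ GZ $ GY) ** commY + mat t ** b" for r s t
    by (simp add: vec_eq_iff forall_gen mat_mult_nth commX_def commY_def algebra_simps)
  ultimately show ?thesis
    unfolding rel_space_def by blast
qed


section \<open>Normal forms\<close>

definition has_normal_form :: "'k::field ^ gen ^ gen \<Rightarrow> bool"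
  where "has_normal_form b \<longleftrightarrow> (\<exists>n. admissible n \<and> graded_equiv b (relator_matrix n))"

lemma has_normal_form_trans: "graded_equiv b b' \<Longrightarrow> has_normal_form b' \<Longrightarrow> has_normal_form b"
  unfolding has_normal_form_def using graded_equiv_trans by blast

lemma has_normal_formI:
  "admissible n \<Longrightarrow> relator_matrix n = b' \<Longrightarrow> graded_equiv b b' \<Longrightarrow> has_normal_form b"
  unfolding has_normal_form_def by blast

lemma sqrt_exists: "\<exists>l::'k::alg_closed_field. l * l = c"
  using nth_root_exists[of 2 c] by (auto simp: power2_eq_square)

lemma scaling_exists:
  fixes c c' :: "'k::alg_closed_field"
  assumes "c \<noteq> 0" "c' \<noteq> 0"
  obtains l where "l \<noteq> 0" "l * l * c = c'"
proof -
  obtain l where "l * l = c' / c" using sqrt_exists by blast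
  with assms have "l \<noteq> 0" "l * l * c = c'" by auto
  then show ?thesis by (rule that)
qed

text \<open>Completing the square by a shift of \<open>x\<close> removes \<open>xz\<close>. If \<open>yz\<close> is present, a new \<open>y\<close> absorbs \<open>zz\<close>;
otherwise \<open>zz\<close> is rescaled.\<close>

lemma has_normal_form_xx:
  fixes u v w :: "'k::{alg_closed_field, field_char_0}"
  shows "has_normal_form (form 1 0 0 0 u v w)"
proof (cases "v = 0")
  case False
  show ?thesis
    using False
    by (intro has_normal_formI[where n = Poly_x, OF _ relator_matrix.simps(11)]
        graded_equiv_form[where a = 1 and b = 0 and c = 0 and d = "1 / v" and e = "- u / 2"
          and h = "(u * u / 4 - w) / v" and l = 1 and m = 1])
      (simp_all add: field_simps)
next
  case v: True
  define w' where "w' = w - u * u / 4"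
  show ?thesis
  proof (cases "w' = 0")
    case True
    then show ?thesis
      by (intro has_normal_formI[where n = R_x2, OF _ relator_matrix.simps(7)]
          graded_equiv_form[where a = 1 and b = 0 and c = 0 and d = 1 and e = "- u / 2"
            and h = 0 and l = 1 and m = 1])
        (simp_all add: v w'_def field_simps)
  next
    case False
    obtain l where l: "l \<noteq> 0" "l * l * w' = - 1"
      using False by (rule scaling_exists[of w' "-1"]) auto
    show ?thesis
      using l
      by (intro has_normal_formI[where n = R_x2_minus_1, OF _ relator_matrix.simps(8)]
          graded_equiv_form[where a = 1 and b = 0 and c = 0 and d = 1 and e = "- l * u / 2"
            and h = 0 and l = l and m = 1])
        (simp_all add: v w'_def field_simps)
  qed
qed

text \<open>The product \<open>(y + hz)(x + ez)\<close> absorbs both linear terms.\<close>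

lemma has_normal_form_yx:
  fixes u v w :: "'k::{alg_closed_field, field_char_0}"
  shows "has_normal_form (form 0 0 1 0 u v w)"
proof (cases "w - u * v = 0")
  case True
  then show ?thesis
    by (intro has_normal_formI[where n = R_yx, OF _ relator_matrix.simps(9)]
        graded_equiv_form[where a = 1 and b = 0 and c = 0 and d = 1 and e = "- v"
          and h = "- u" and l = 1 and m = 1])
      (simp_all add: field_simps)
next
  case False
  obtain l where l: "l \<noteq> 0" "l * l * (w - u * v) = - 1"
    using False by (rule scaling_exists[of "w - u * v" "-1"]) auto
  show ?thesis
    using l
    by (intro has_normal_formI[where n = S, OF _ relator_matrix.simps(10)]
        graded_equiv_form[where a = 1 and b = 0 and c = 0 and d = 1 and e = "- l * v"
          and h = "- l * u" and l = l and m = 1])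
      (simp_all add: field_simps)
qed

text \<open>For \<open>q \<noteq> 1\<close> the symmetric part of \<open>xy - qyx\<close> is non-degenerate, so shifts of \<open>x\<close> and \<open>y\<close> remove the
linear terms.\<close>

lemma has_normal_form_q:
  fixes u v w q :: "'k::{alg_closed_field, field_char_0}"
  assumes q: "q \<noteq> 0" "q \<noteq> 1"
  shows "has_normal_form (form 0 1 (-q) 0 u v w)"
proof -
  define w' where "w' = w - u * v / (1 - q)"
  define \<kappa> where "\<kappa> = 1 / (1 - q)"
  have \<kappa>: "(1 - q) * \<kappa> = 1" using q by (simp add: \<kappa>_def)
  have w': "w' = w - u * v * \<kappa>" by (simp add: w'_def \<kappa>_def)
  have kill: "graded_equiv (form 0 1 (-q) 0 u v w) (form 0 1 (-q) 0 0 0 (l * l * w'))" if "l \<noteq> 0" for l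
  proof (rule graded_equiv_form[where a = 1 and b = 0 and c = 0 and d = 1 and e = "- l * v * \<kappa>"
          and h = "- l * u * \<kappa>" and l = l and m = 1])
    have "(1 - q) * (l * v * \<kappa>) = l * v" "(1 - q) * (l * u * \<kappa>) = l * u" for v
      using \<kappa> by (metis mult.commute mult.left_commute mult_1_right)+
    then show "2 * 0 * 1 * (- l * v * \<kappa>) + (1 + - q) * (1 * (- l * u * \<kappa>) + 0 * (- l * v * \<kappa>)) +
        2 * 0 * 0 * (- l * u * \<kappa>) + l * (u * 1 + v * 0) = 1 * 0"
      "2 * 0 * 0 * (- l * v * \<kappa>) + (1 + - q) * (0 * (- l * u * \<kappa>) + 1 * (- l * v * \<kappa>)) +
        2 * 0 * 1 * (- l * u * \<kappa>) + l * (u * 0 + v * 1) = 1 * 0"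
      by simp_all
    have "(1 - q) * (l * v * \<kappa>) * (l * u * \<kappa>) = l * v * ((1 - q) * \<kappa>) * (l * u * \<kappa>)"
      by (simp only: mult_ac)
    then have "(1 - q) * (l * v * \<kappa>) * (l * u * \<kappa>) = l * v * (l * u * \<kappa>)"
      by (simp add: \<kappa>)
    then show "0 * (- l * v * \<kappa>) * (- l * v * \<kappa>) + (1 + - q) * (- l * v * \<kappa>) * (- l * u * \<kappa>) +
        0 * (- l * u * \<kappa>) * (- l * u * \<kappa>) + l * (u * (- l * v * \<kappa>) + v * (- l * u * \<kappa>)) +
        l * l * w = 1 * (l * l * w')"
      by (simp add: w' algebra_simps)
  qed (use that in simp_all)
  show ?thesis
  proof (cases "w' = 0")
    case True
    then show ?thesis
      using kill[of 1] q by (intro has_normal_formI[where n = "Quantum_plane q", OF _ relator_matrix.simps(1)]) simp_all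
  next
    case False
    obtain l where l: "l \<noteq> 0" "l * l * w' = - 1"
      using False by (rule scaling_exists[of w' "-1"]) auto
    then show ?thesis
      using kill[of l] q by (intro has_normal_formI[where n = "Quantum_Weyl q", OF _ relator_matrix.simps(2)]) simp_all
  qed
qed

text \<open>For \<open>q = 1\<close> shifts by \<open>z\<close> leave the linear terms alone, but every base change of the plane of \<open>x\<close> and \<open>y\<close>
preserves the commutator up to a factor. If \<open>u\<close> or \<open>v\<close> is non-zero, the cofactor \<open>ux + vy + wz\<close> of \<open>z\<close> can
therefore be taken as the new \<open>y\<close>.\<close>

lemma has_normal_form_commutator:
  fixes u v w :: "'k::{alg_closed_field, field_char_0}"
  shows "has_normal_form (form 0 1 (-1) 0 u v w)"
proof -
  \<comment> \<open>With \<open>vy' = ux + vy + wz\<close> the relator becomes \<open>xy' - y'x + vy'z\<close>; then \<open>z\<close> and the relator are rescaled.\<close>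
  have v: "has_normal_form (form 0 1 (-1) 0 u v w)" if "v \<noteq> 0" for u v w :: 'k
    using that
    by (intro has_normal_formI[where n = U, OF _ relator_matrix.simps(5)]
        graded_equiv_form[where a = 1 and b = 0 and c = "- u / v" and d = 1 and e = 0
          and h = "w / (v * v)" and l = "- 1 / v" and m = "-1"])
      (simp_all add: field_simps)
  consider "v \<noteq> 0" | "v = 0" "u \<noteq> 0" | "v = 0" "u = 0" "w = 0" | "v = 0" "u = 0" "w \<noteq> 0"
    by blast
  then show ?thesis
  proof cases
    case 1
    then show ?thesis by (rule v)
  next
    case 2
    have "graded_equiv (form 0 1 (-1) 0 u v w) (form 0 1 (-1) 0 0 (- u) (- w))"
      by (rule graded_equiv_form[where a = 0 and b = 1 and c = 1 and d = 0 and e = 0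
            and h = 0 and l = 1 and m = "-1"]) (simp_all add: 2)
    then show ?thesis by (rule has_normal_form_trans) (use 2 v in simp)
  next
    case 3
    then show ?thesis
      by (intro has_normal_formI[where n = "Quantum_plane 1", OF _ relator_matrix.simps(1)])
         (simp_all add: graded_equiv_refl)
  next
    case 4
    obtain l where l: "l \<noteq> 0" "l * l * w = - 1"
      using 4(3) by (rule scaling_exists[of w "-1"]) auto
    show ?thesis
      using l
      by (intro has_normal_formI[where n = "Quantum_Weyl 1", OF _ relator_matrix.simps(2)]
          graded_equiv_form[where a = 1 and b = 0 and c = 0 and d = 1 and e = 0
            and h = 0 and l = l and m = 1])
        (simp_all add: 4)
  qed
qed

text \<open>The symmetric part \<open>yy\<close> is degenerate: a shift of \<open>y\<close> removes \<open>yz\<close>, while \<open>xz\<close> stays. If it is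
present, a shift of \<open>x\<close> absorbs \<open>zz\<close>.\<close>

lemma has_normal_form_Jordan:
  fixes u v w :: "'k::{alg_closed_field, field_char_0}"
  shows "has_normal_form (form 0 (-1) 1 1 u v w)"
proof -
  define w' where "w' = w - v * v / 4"
  consider "u \<noteq> 0" | "u = 0" "w' = 0" | "u = 0" "w' \<noteq> 0" by blast
  then show ?thesis
  proof cases
    case 1
    then show ?thesis
      by (intro has_normal_formI[where n = V, OF _ relator_matrix.simps(6)]
          graded_equiv_form[where a = 1 and b = 0 and c = 0 and d = 1 and e = "- w' / (u * u)"
            and h = "- v / (2 * u)" and l = "1 / u" and m = 1])
        (simp_all add: w'_def field_simps)
  next
    case 2
    then show ?thesis
      by (intro has_normal_formI[where n = J, OF _ relator_matrix.simps(3)]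
          graded_equiv_form[where a = 1 and b = 0 and c = 0 and d = 1 and e = 0
            and h = "- v / 2" and l = 1 and m = 1])
        (simp_all add: w'_def field_simps)
  next
    case 3
    obtain l where l: "l \<noteq> 0" "l * l * w' = 1"
      using 3(2) by (rule scaling_exists[of w' "1"]) auto
    then show ?thesis
      using 3 by (intro has_normal_formI[where n = J1, OF _ relator_matrix.simps(4)]
          graded_equiv_form[where a = 1 and b = 0 and c = 0 and d = 1 and e = 0
            and h = "- l * v / 2" and l = l and m = 1])
        (simp_all add: w'_def field_simps)
  qed
qed

lemma has_normal_form_hyperbolic:
  fixes \<beta> \<gamma> u v w :: "'k::{alg_closed_field, field_char_0}"
  assumes "\<beta> \<noteq> 0 \<or> \<gamma> \<noteq> 0"
  shows "has_normal_form (form 0 \<beta> \<gamma> 0 u v w)"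
proof -
  consider "\<beta> = 0" "\<gamma> \<noteq> 0" | "\<beta> \<noteq> 0" "\<gamma> = 0" | "\<beta> \<noteq> 0" "\<gamma> \<noteq> 0" using assms by blast
  then show ?thesis
  proof cases
    case 1
    have "graded_equiv (form 0 \<beta> \<gamma> 0 u v w) (form 0 0 1 0 (u / \<gamma>) (v / \<gamma>) (w / \<gamma>))"
      by (rule graded_equiv_form[where a = 1 and b = 0 and c = 0 and d = 1 and e = 0
            and h = 0 and l = 1 and m = \<gamma>]) (simp_all add: 1)
    then show ?thesis by (rule has_normal_form_trans) (rule has_normal_form_yx)
  next
    case 2
    have "graded_equiv (form 0 \<beta> \<gamma> 0 u v w) (form 0 0 1 0 (v / \<beta>) (u / \<beta>) (w / \<beta>))"
      by (rule graded_equiv_form[where a = 0 and b = 1 and c = 1 and d = 0 and e = 0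
            and h = 0 and l = 1 and m = \<beta>]) (simp_all add: 2)
    then show ?thesis by (rule has_normal_form_trans) (rule has_normal_form_yx)
  next
    case 3
    define q where "q = - \<gamma> / \<beta>"
    have "graded_equiv (form 0 \<beta> \<gamma> 0 u v w) (form 0 1 (- q) 0 (u / \<beta>) (v / \<beta>) (w / \<beta>))"
      by (rule graded_equiv_form[where a = 1 and b = 0 and c = 0 and d = 1 and e = 0
            and h = 0 and l = 1 and m = \<beta>]) (simp_all add: 3 q_def)
    moreover have "has_normal_form (form 0 1 (- q) 0 (u / \<beta>) (v / \<beta>) (w / \<beta>))"
    proof (cases "q = 1")
      case True
      then show ?thesis using has_normal_form_commutator by simp
    next
      case False
      then show ?thesis using 3 by (intro has_normal_form_q) (simp_all add: q_def)
    qed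
    ultimately show ?thesis by (rule has_normal_form_trans)
  qed
qed

text \<open>If \<open>\<beta> + \<gamma> \<noteq> 0\<close>, the vectors dual to \<open>x\<close> and \<open>y\<close> span a hyperbolic plane and the second can be made isotropic
as well. Otherwise \<open>\<beta>xy + \<gamma>yx\<close> is a multiple of the commutator; together with a non-zero \<open>\<delta>\<close> this gives
the Jordan plane, or a square if the multiple is zero.\<close>

lemma has_normal_form_isotropic:
  fixes \<beta> \<gamma> \<delta> u v w :: "'k::{alg_closed_field, field_char_0}"
  assumes "\<beta> \<noteq> 0 \<or> \<gamma> \<noteq> 0 \<or> \<delta> \<noteq> 0"
  shows "has_normal_form (form 0 \<beta> \<gamma> \<delta> u v w)"
proof -
  consider "\<beta> + \<gamma> \<noteq> 0" | "\<beta> = - \<gamma>" "\<gamma> \<noteq> 0" "\<delta> = 0" | "\<beta> = - \<gamma>" "\<gamma> \<noteq> 0" "\<delta> \<noteq> 0"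
    | "\<beta> = 0" "\<gamma> = 0" "\<delta> \<noteq> 0"
  proof (cases "\<beta> + \<gamma> = 0")
    case True
    then have "\<beta> = - \<gamma>" by (simp add: eq_neg_iff_add_eq_0)
    with that assms show ?thesis by (cases "\<gamma> = 0"; cases "\<delta> = 0"; simp)
  qed (use that in blast)
  then show ?thesis
  proof cases
    case 1
    define b where "b = - \<delta> / (\<beta> + \<gamma>)"
    have "(\<beta> + \<gamma>) * b = - \<delta>" using 1 by (simp add: b_def)
    then have "graded_equiv (form 0 \<beta> \<gamma> \<delta> u v w) (form 0 \<beta> \<gamma> 0 u (u * b + v) w)"
      by (intro graded_equiv_form[where a = 1 and b = b and c = 0 and d = 1 and e = 0
            and h = 0 and l = 1 and m = 1]) simp_all
    then show ?thesis
      by (rule has_normal_form_trans) (use 1 in \<open>auto intro: has_normal_form_hyperbolic\<close>)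
  next
    case 2
    then show ?thesis using has_normal_form_hyperbolic[of \<beta> \<gamma>] by simp
  next
    case 3
    have "graded_equiv (form 0 \<beta> \<gamma> \<delta> u v w) (form 0 (-1) 1 1 (u / \<gamma>) (v / \<delta>) (w / \<delta>))"
      by (rule graded_equiv_form[where a = "\<delta> / \<gamma>" and b = 0 and c = 0 and d = 1 and e = 0
            and h = 0 and l = 1 and m = \<delta>]) (simp_all add: 3)
    then show ?thesis by (rule has_normal_form_trans) (rule has_normal_form_Jordan)
  next
    case 4
    have "graded_equiv (form 0 \<beta> \<gamma> \<delta> u v w) (form 1 0 0 0 (v / \<delta>) (u / \<delta>) (w / \<delta>))"
      by (rule graded_equiv_form[where a = 0 and b = 1 and c = 1 and d = 0 and e = 0
            and h = 0 and l = 1 and m = \<delta>]) (simp_all add: 4)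
    then show ?thesis by (rule has_normal_form_trans) (rule has_normal_form_xx)
  qed
qed

lemma isotropic_vector_exists:
  fixes \<alpha> \<epsilon> \<delta> :: "'k::alg_closed_field"
  obtains a c where "a \<noteq> 0 \<or> c \<noteq> 0" "\<alpha> * a * a + \<epsilon> * a * c + \<delta> * c * c = 0"
proof (cases "\<alpha> = 0")
  case True
  then show ?thesis using that[of 1 0] by simp
next
  case False
  then have "degree [:\<delta>, \<epsilon>, \<alpha>:] > 0" by simp
  then obtain x where "poly [:\<delta>, \<epsilon>, \<alpha>:] x = 0"
    using alg_closed_imp_poly_has_root by blast
  then show ?thesis using that[of x 1] by (simp add: algebra_simps)
qed

text \<open>Over an algebraically closed field some vector is isotropic for \<open>\<alpha>xx + \<beta>xy + \<gamma>yx + \<delta>yy\<close>; a base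
change whose first vector it is makes the coefficient of \<open>xx\<close> vanish.\<close>

theorem has_normal_form:
  fixes \<alpha> \<beta> \<gamma> \<delta> u v w :: "'k::{alg_closed_field, field_char_0}"
  assumes nz: "\<alpha> \<noteq> 0 \<or> \<beta> \<noteq> 0 \<or> \<gamma> \<noteq> 0 \<or> \<delta> \<noteq> 0"
  shows "has_normal_form (form \<alpha> \<beta> \<gamma> \<delta> u v w)"
proof -
  obtain a c where ac: "a \<noteq> 0 \<or> c \<noteq> 0" "\<alpha> * a * a + (\<beta> + \<gamma>) * a * c + \<delta> * c * c = 0"
    by (rule isotropic_vector_exists)
  \<comment> \<open>Complete \<open>(a, c)\<close> to a matrix of determinant one.\<close>
  define b where "b = (if a = 0 then - 1 / c else 0)"
  define d where "d = (if a = 0 then 0 else 1 / a)"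
  have det: "a * d - b * c \<noteq> 0" using ac(1) by (simp add: b_def d_def)
  define \<beta>' where "\<beta>' = \<alpha> * a * b + \<beta> * a * d + \<gamma> * b * c + \<delta> * c * d"
  define \<gamma>' where "\<gamma>' = \<alpha> * a * b + \<beta> * b * c + \<gamma> * a * d + \<delta> * c * d"
  define \<delta>' where "\<delta>' = \<alpha> * b * b + (\<beta> + \<gamma>) * b * d + \<delta> * d * d"
  have "graded_equiv (form \<alpha> \<beta> \<gamma> \<delta> u v w) (form 0 \<beta>' \<gamma>' \<delta>' (u * a + v * c) (u * b + v * d) w)"
    using det ac(2)
    by (intro graded_equiv_form[where a = a and b = b and c = c and d = d and e = 0
          and h = 0 and l = 1 and m = 1]) (simp_all add: \<beta>'_def \<gamma>'_def \<delta>'_def)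
  moreover have "\<beta>' \<noteq> 0 \<or> \<gamma>' \<noteq> 0 \<or> \<delta>' \<noteq> 0"
    using ac nz by (auto simp: \<beta>'_def \<gamma>'_def \<delta>'_def b_def d_def split: if_splits)
  ultimately show ?thesis
    by (blast intro: has_normal_form_trans has_normal_form_isotropic)
qed

corollary exists_isomorphic_relator:
  fixes f :: "(gen, 'k::{alg_closed_field, field_char_0}) free_alg"
  assumes "homogeneous 2 f"
    and "\<exists>w\<in>{Word [GX, GX], Word [GX, GY], Word [GY, GX], Word [GY, GY]}. Poly_Mapping.lookup f w \<noteq> 0"
  shows "\<exists>n. admissible n \<and> H f \<cong>\<^sub>a\<^sub>l\<^sub>g H (relator n)"
proof -
  define b where "b = quad_part f"
  have f: "f = quad b" unfolding b_def by (rule homogeneous_2_eq_quad[OF assms(1)])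
  have "has_normal_form (form (b $ GX $ GX) (b $ GX $ GY) (b $ GY $ GX) (b $ GY $ GY)
     (b $ GX $ GZ + b $ GZ $ GX) (b $ GY $ GZ + b $ GZ $ GY) (b $ GZ $ GZ))"
    using assms(2) by (intro has_normal_form) (auto simp: b_def quad_part_def)
  then obtain n where "admissible n" "graded_equiv b (relator_matrix n)"
    unfolding has_normal_form_def graded_equiv_def rel_space_form[of b, symmetric] by blast
  then show ?thesis
    using graded_equiv_imp_isomorphic[of b] unfolding f relator_eq_quad by blast
qed


section \<open>Invariants of the space of relations\<close>

text \<open>Twice the symmetric part. It vanishes on the commutators, so it is determined by the space of
relations up to a factor, and it transforms by congruence.\<close>

definition symm :: "'k::field ^ 'g ^ 'g \<Rightarrow> 'k ^ 'g ^ 'g"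
  where "symm b = b + transpose b"

lemma symm_nth: "symm b $ i $ j = b $ i $ j + b $ j $ i"
  by (simp add: symm_def transpose_def)

definition det2 :: "'k::field ^ gen ^ gen \<Rightarrow> 'k"
  where "det2 A = A $ GX $ GX * A $ GY $ GY - A $ GX $ GY * A $ GY $ GX"

text \<open>Rank at most one is expressed by a factorisation because congruence acts on the two factors.\<close>

definition rank_le_1 :: "'k::field ^ 'g ^ 'g \<Rightarrow> bool"
  where "rank_le_1 A \<longleftrightarrow> (\<exists>u v. \<forall>i j. A $ i $ j = u i * v j)"

definition xy_block_zero :: "'k::field ^ gen ^ gen \<Rightarrow> bool"
  where "xy_block_zero A \<longleftrightarrow>
    A $ GX $ GX = 0 \<and> A $ GX $ GY = 0 \<and> A $ GY $ GX = 0 \<and> A $ GY $ GY = 0"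

lemma rank_le_1_minor:
  "rank_le_1 A \<Longrightarrow> A $ i $ k * A $ j $ l = A $ i $ l * A $ j $ k"
  by (auto simp: rank_le_1_def)

lemma rank_le_1_congr: "rank_le_1 A \<Longrightarrow> rank_le_1 (congr L A)"
proof -
  assume "rank_le_1 A"
  then obtain u v where uv: "\<And>i j. A $ i $ j = u i * v j"
    by (auto simp: rank_le_1_def)
  have "congr L A $ k $ l = (\<Sum>i\<in>UNIV. u i * L $ i $ k) * (\<Sum>j\<in>UNIV. v j * L $ j $ l)" for k l
    unfolding congr_nth uv sum_product by (simp add: mult_ac)
  then show ?thesis
    unfolding rank_le_1_def
    by (intro exI[of _ "\<lambda>k. \<Sum>i\<in>UNIV. u i * L $ i $ k"] exI[of _ "\<lambda>l. \<Sum>j\<in>UNIV. v j * L $ j $ l"]) simp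
qed

lemma rank_le_1_scale:
  assumes "m \<noteq> 0" "rank_le_1 (mat m ** A)"
  shows "rank_le_1 A"
proof -
  from assms(2) obtain u v where "\<And>i j. m * A $ i $ j = u i * v j"
    by (auto simp: rank_le_1_def mat_mult_nth)
  then have "A $ i $ j = (u i / m) * v j" for i j
    using assms(1) by (simp add: field_simps)
  then show ?thesis
    unfolding rank_le_1_def by (intro exI[of _ "\<lambda>i. u i / m"] exI[of _ v]) blast
qed

lemma symm_congr: "symm (congr L b) = congr L (symm b)"
proof -
  have "transpose (congr L b) = congr L (transpose b)"
    by (simp add: congr_def matrix_transpose_mul matrix_mul_assoc)
  then show ?thesis
    by (simp add: symm_def congr_add)
qed

lemma symm_rel:
  "symm (mat r ** commX + mat s ** commY + mat t ** b) = mat t ** symm b"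
  by (simp add: vec_eq_iff forall_gen symm_nth mat_mult_nth commX_def commY_def algebra_simps)

lemma congr_eq_zero_iff:
  assumes "invertible L"
  shows "congr L A = 0 \<longleftrightarrow> A = 0"
proof -
  obtain M where M: "L ** M = mat 1"
    using assms by (auto simp: invertible_def)
  have "congr M (congr L A) = transpose (L ** M) ** A ** (L ** M)"
    by (simp add: congr_def matrix_transpose_mul matrix_mul_assoc)
  then have "congr M (congr L A) = A" by (simp add: M)
  moreover have "congr K 0 = 0" for K :: "'a ^ 'b ^ 'b"
    by (simp add: vec_eq_iff congr_nth)
  ultimately show ?thesis by metis
qed

lemma rel_map_symm:
  assumes "congr L ` rel_space b \<subseteq> rel_space b'"
  obtains r s m where "congr L b = mat r ** commX + mat s ** commY + mat m ** b'"
    "congr L (symm b) = mat m ** symm b'"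
proof -
  have "b \<in> rel_space b"
    by (rule rel_spaceI[of _ 0 0 1]) (simp add: vec_eq_iff mat_mult_nth)
  with assms have "congr L b \<in> rel_space b'" by blast
  then obtain r s m where b: "congr L b = mat r ** commX + mat s ** commY + mat m ** b'"
    by (auto simp: rel_space_def)
  have "congr L (symm b) = mat m ** symm b'"
    unfolding symm_congr[symmetric] b symm_rel ..
  with b show ?thesis by (rule that)
qed

lemma symm_zero_reflect:
  assumes "invertible L" "congr L ` rel_space b \<subseteq> rel_space b'" "symm b' = 0"
  shows "symm b = 0"
proof -
  obtain m where "congr L (symm b) = mat m ** symm b'"
    using assms(2) by (rule rel_map_symm)
  then have "congr L (symm b) = 0"
    using assms(3) by (simp add: vec_eq_iff mat_mult_nth)
  with assms(1) show ?thesis by (simp add: congr_eq_zero_iff)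
qed

text \<open>If the symmetric part of the relator is non-zero, the skew relations are exactly those of the
form \<open>vz - zv\<close>, so they determine the line spanned by \<open>z\<close>. Concretely, the commutator of the image of \<open>z\<close>
with the image of any generator has no \<open>xy\<close> term.\<close>

lemma central_generator_preserved:
  assumes L: "invertible L" and sub: "congr L ` rel_space b \<subseteq> rel_space b'"
    and nz: "symm b' \<noteq> 0"
  shows "L $ GZ $ GX = 0" "L $ GZ $ GY = 0"
proof -
  have comm: "congr L A $ GX $ GY = 0" if "A \<in> rel_space b" "symm A = 0" for A
  proof -
    have "congr L A \<in> rel_space b'" using that(1) sub by blast
    then obtain r s t where A: "congr L A = mat r ** commX + mat s ** commY + mat t ** b'"
      by (auto simp: rel_space_def)
    have "mat t ** symm b' = congr L (symm A)"
      unfolding symm_congr[symmetric] A symm_rel ..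
    also have "\<dots> = 0"
      using that(2) by (simp add: congr_eq_zero_iff[OF L])
    finally have "mat t ** symm b' = 0" .
    then have "t = 0"
      using nz by (auto simp: vec_eq_iff mat_mult_nth)
    then show ?thesis
      by (simp add: A mat_mult_nth commX_def commY_def)
  qed
  have "congr L commX $ GX $ GY = 0"
    by (rule comm) (rule rel_spaceI[of _ 1 0 0],
      simp_all add: vec_eq_iff forall_gen symm_nth mat_mult_nth commX_def)
  moreover have "congr L commY $ GX $ GY = 0"
    by (rule comm) (rule rel_spaceI[of _ 0 1 0],
      simp_all add: vec_eq_iff forall_gen symm_nth mat_mult_nth commY_def)
  ultimately have eqs: "L $ GX $ GX * L $ GZ $ GY = L $ GZ $ GX * L $ GX $ GY"
      "L $ GY $ GX * L $ GZ $ GY = L $ GZ $ GX * L $ GY $ GY"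
    by (simp_all add: congr_nth sum_gen commX_def commY_def)
  \<comment> \<open>The commutator conditions say that the rows of \<open>L\<close> are orthogonal to this vector.\<close>
  define x where "x = (\<chi> i. case i of GX \<Rightarrow> L $ GZ $ GY | GY \<Rightarrow> - (L $ GZ $ GX) | GZ \<Rightarrow> 0)"
  have "L *v x = 0"
    using eqs by (simp add: vec_eq_iff forall_gen matrix_vector_mult_def sum_gen x_def)
  moreover obtain M where "M ** L = mat 1"
    using L by (auto simp: invertible_def)
  ultimately have "x = 0"
    by (metis matrix_vector_mul_assoc matrix_vector_mul_lid matrix_vector_mult_0_right)
  then have "x $ GX = 0" "x $ GY = 0" by simp_all
  then show "L $ GZ $ GX = 0" "L $ GZ $ GY = 0" by (simp_all add: x_def)
qed

lemma det2_congr: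
  assumes "L $ GZ $ GX = 0" "L $ GZ $ GY = 0"
  shows "det2 (congr L A) = (det2 L)\<^sup>2 * det2 A"
  by (simp add: det2_def congr_nth sum_gen assms power2_eq_square) (simp add: algebra_simps)

text \<open>The relator and its symmetric part are transformed by the same matrix and rescaled by the same factor
\<open>m\<close>. As \<open>z\<close> is preserved, so are their restrictions to the \<open>xy\<close>-block, and the two determinants of
these restrictions change by the common factor \<open>(det2 L)\<^sup>2 / m\<^sup>2\<close>. Their ratio is the invariant that
detects \<open>q\<close>.\<close>

lemma rel_map_invariants:
  assumes L: "invertible L" and sub: "congr L ` rel_space b \<subseteq> rel_space b'"
    and nz: "symm b \<noteq> 0"
  shows "det (symm b) = 0 \<longleftrightarrow> det (symm b') = 0"
    and "rank_le_1 (symm b) \<Longrightarrow> rank_le_1 (symm b')"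
    and "xy_block_zero (symm b) \<Longrightarrow> xy_block_zero (symm b')"
    and "det2 b = 0 \<longleftrightarrow> det2 b' = 0"
    and "det2 (symm b) = 0 \<longleftrightarrow> det2 (symm b') = 0"
    and "det2 b * det2 (symm b') = det2 b' * det2 (symm b)"
proof -
  obtain r s m where b: "congr L b = mat r ** commX + mat s ** commY + mat m ** b'"
      and sb: "congr L (symm b) = mat m ** symm b'"
    using sub by (rule rel_map_symm)
  have "m \<noteq> 0" "symm b' \<noteq> 0"
    using nz sb congr_eq_zero_iff[OF L, of "symm b"] by (auto simp: vec_eq_iff mat_mult_nth)
  note z = central_generator_preserved[OF L sub \<open>symm b' \<noteq> 0\<close>]
  have "det L \<noteq> 0" using L by (simp add: invertible_det_nz)
  then have d: "det2 L \<noteq> 0"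
    by (auto simp: det_gen det2_def z algebra_simps)
  have "det L * det (symm b) * det L = det (mat m :: 'a ^ gen ^ gen) * det (symm b')"
    using arg_cong[OF sb, of det] by (simp add: congr_def det_mul det_transpose)
  moreover have "det (mat m :: 'a ^ gen ^ gen) \<noteq> 0"
    using \<open>m \<noteq> 0\<close> by (simp add: det_gen mat_def)
  ultimately show "det (symm b) = 0 \<longleftrightarrow> det (symm b') = 0"
    using \<open>det L \<noteq> 0\<close> by (metis mult_eq_0_iff)
  show "rank_le_1 (symm b')" if "rank_le_1 (symm b)"
    using rank_le_1_congr[OF that, of L] unfolding sb by (rule rank_le_1_scale[OF \<open>m \<noteq> 0\<close>])
  show "xy_block_zero (symm b')" if "xy_block_zero (symm b)"
  proof -
    have "m * symm b' $ k $ l = (\<Sum>i\<in>UNIV. \<Sum>j\<in>UNIV. symm b $ i $ j * (L $ i $ k * L $ j $ l))" for k l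
      using arg_cong[OF sb, of "\<lambda>A. A $ k $ l"] by (simp add: congr_nth mat_mult_nth)
    then have "m * symm b' $ k $ l = 0" if "k \<noteq> GZ" "l \<noteq> GZ" for k l
      using that \<open>xy_block_zero (symm b)\<close> z
      by (cases k; cases l; simp add: sum_gen xy_block_zero_def)
    then show ?thesis using \<open>m \<noteq> 0\<close> by (simp add: xy_block_zero_def)
  qed
  have e1: "(det2 L)\<^sup>2 * det2 b = m\<^sup>2 * det2 b'"
    using det2_congr[OF z, of b] unfolding b
    by (simp add: det2_def mat_mult_nth commX_def commY_def power2_eq_square algebra_simps)
  have e2: "(det2 L)\<^sup>2 * det2 (symm b) = m\<^sup>2 * det2 (symm b')"
    using det2_congr[OF z, of "symm b"] unfolding sb
    by (simp add: det2_def mat_mult_nth power2_eq_square algebra_simps)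
  show "det2 b = 0 \<longleftrightarrow> det2 b' = 0"
    using e1 d \<open>m \<noteq> 0\<close> by (metis mult_eq_0_iff power_eq_0_iff)
  show "det2 (symm b) = 0 \<longleftrightarrow> det2 (symm b') = 0"
    using e2 d \<open>m \<noteq> 0\<close> by (metis mult_eq_0_iff power_eq_0_iff)
  have "((det2 L)\<^sup>2 * det2 b) * (m\<^sup>2 * det2 (symm b')) = (m\<^sup>2 * det2 b') * ((det2 L)\<^sup>2 * det2 (symm b))"
    by (simp only: e1 e2)
  then have "((det2 L)\<^sup>2 * m\<^sup>2) * (det2 b * det2 (symm b')) = ((det2 L)\<^sup>2 * m\<^sup>2) * (det2 b' * det2 (symm b))"
    by (simp add: mult_ac)
  then show "det2 b * det2 (symm b') = det2 b' * det2 (symm b)"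
    using d \<open>m \<noteq> 0\<close> by simp
qed

theorem isomorphic_imp_same_invariants:
  assumes "H (quad b) \<cong>\<^sub>a\<^sub>l\<^sub>g H (quad b')"
  shows "symm b = 0 \<longleftrightarrow> symm b' = 0"
    and "symm b \<noteq> 0 \<Longrightarrow> det (symm b) = 0 \<longleftrightarrow> det (symm b') = 0"
    and "symm b \<noteq> 0 \<Longrightarrow> rank_le_1 (symm b) \<longleftrightarrow> rank_le_1 (symm b')"
    and "symm b \<noteq> 0 \<Longrightarrow> xy_block_zero (symm b) \<longleftrightarrow> xy_block_zero (symm b')"
    and "symm b \<noteq> 0 \<Longrightarrow> det2 b = 0 \<longleftrightarrow> det2 b' = 0"
    and "symm b \<noteq> 0 \<Longrightarrow> det2 (symm b) = 0 \<longleftrightarrow> det2 (symm b') = 0"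
    and "symm b \<noteq> 0 \<Longrightarrow> det2 b * det2 (symm b') = det2 b' * det2 (symm b)"
proof -
  obtain L M where L: "invertible L" "congr L ` rel_space b \<subseteq> rel_space b'"
      and M: "invertible M" "congr M ` rel_space b' \<subseteq> rel_space b"
    using quadratic_algebra_isomorphicD[OF matrix_subspace_rel_space matrix_subspace_rel_space
        assms[unfolded H_quad]] by blast
  show eq: "symm b = 0 \<longleftrightarrow> symm b' = 0"
    using symm_zero_reflect[OF L] symm_zero_reflect[OF M] by blast
  assume "symm b \<noteq> 0"
  moreover from this have "symm b' \<noteq> 0" by (simp add: eq)
  ultimately show "det (symm b) = 0 \<longleftrightarrow> det (symm b') = 0"
      "rank_le_1 (symm b) \<longleftrightarrow> rank_le_1 (symm b')"
      "xy_block_zero (symm b) \<longleftrightarrow> xy_block_zero (symm b')"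
      "det2 b = 0 \<longleftrightarrow> det2 b' = 0"
      "det2 (symm b) = 0 \<longleftrightarrow> det2 (symm b') = 0"
      "det2 b * det2 (symm b') = det2 b' * det2 (symm b)"
    using rel_map_invariants[OF L] rel_map_invariants[OF M] by blast+
qed

lemma symm_form:
  "symm (form \<alpha> \<beta> \<gamma> \<delta> u v w) = mat9 (2 * \<alpha>) (\<beta> + \<gamma>) u (\<beta> + \<gamma>) (2 * \<delta>) v u v (2 * w)"
  by (simp add: vec_eq_iff forall_gen symm_nth add.commute)

lemma mat9_eq_zero_iff: "mat9 a b c d e f g h i = 0 \<longleftrightarrow>
   a = 0 \<and> b = 0 \<and> c = 0 \<and> d = 0 \<and> e = 0 \<and> f = 0 \<and> g = 0 \<and> h = 0 \<and> i = 0"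
  by (auto simp: vec_eq_iff forall_gen)

lemma rank_le_1_diag:
  "rank_le_1 (mat9 a 0 0 0 b 0 0 0 c) \<longleftrightarrow> a * b = 0 \<and> a * c = 0 \<and> b * c = 0"
proof
  assume r: "rank_le_1 (mat9 a 0 0 0 b 0 0 0 c)"
  show "a * b = 0 \<and> a * c = 0 \<and> b * c = 0"
    using rank_le_1_minor[OF r, of GX GX GY GY] rank_le_1_minor[OF r, of GX GX GZ GZ]
      rank_le_1_minor[OF r, of GY GY GZ GZ] by simp
next
  assume "a * b = 0 \<and> a * c = 0 \<and> b * c = 0"
  then show "rank_le_1 (mat9 a 0 0 0 b 0 0 0 c)"
    unfolding rank_le_1_def forall_gen
    by (intro exI[of _ "\<lambda>i. case i of GX \<Rightarrow> if a = 0 then 0 else 1 | GY \<Rightarrow> if b = 0 then 0 else 1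
            | GZ \<Rightarrow> if c = 0 then 0 else 1"]
          exI[of _ "\<lambda>i. case i of GX \<Rightarrow> a | GY \<Rightarrow> b | GZ \<Rightarrow> c"]) auto
qed

lemma not_rank_le_1:
  "b * b \<noteq> a * e \<Longrightarrow> \<not> rank_le_1 (mat9 a b c b e f g h i)"
  "f * f \<noteq> e * i \<Longrightarrow> \<not> rank_le_1 (mat9 a b c d e f g f i)"
  using rank_le_1_minor[of "mat9 a b c b e f g h i" GX GX GY GY]
    rank_le_1_minor[of "mat9 a b c d e f g f i" GY GY GZ GZ] by auto

text \<open>The rank of the \<open>3 \<times> 3\<close> symmetric part, from three down to zero, splits the normal forms into four
groups. Within each group they differ in which of the two determinants of the \<open>xy\<close>-block vanish,
except for the Jordan types against the commutator types of the same rank, which the vanishing of the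
symmetric block tells apart. For the two families with a parameter the ratio of the determinants is
\<open>-(1 - q)\<^sup>2 / q\<close>, which is symmetric under inversion of \<open>q\<close> and takes every value at one such pair only.\<close>

lemma isomorphic_relators_imp:
  fixes m n :: "'k::field_char_0 name"
  assumes adm: "admissible m" "admissible n" and iso: "H (relator m) \<cong>\<^sub>a\<^sub>l\<^sub>g H (relator n)"
  shows "m = n \<or> (\<exists>q. m = Quantum_plane q \<and> n = Quantum_plane (inverse q))
    \<or> (\<exists>q. m = Quantum_Weyl q \<and> n = Quantum_Weyl (inverse q))"
proof -
  note inv = isomorphic_imp_same_invariants[OF iso[unfolded relator_eq_quad]]
  have q: "p = q \<or> q = inverse p"
    if "p * ((1 - q) * (1 - q)) = q * ((1 - p) * (1 - p))" for p q :: 'k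
  proof -
    have "(p - q) * (1 - p * q) = 0"
      using that(1) by (simp add: algebra_simps)
    then have "p = q \<or> p * q = 1" by auto
    then show ?thesis
      using inverse_unique[of p q] by auto
  qed
  note tables = symm_form mat9_eq_zero_iff det_gen det2_def xy_block_zero_def
    rank_le_1_diag not_rank_le_1
  show ?thesis
    using adm inv
    by (cases m; cases n; simp add: tables; metis q)
qed

text \<open>Exchanging \<open>x\<close> and \<open>y\<close> turns \<open>xy - qyx\<close> into \<open>-q\<close> times \<open>xy - q\<^sup>-\<^sup>1yx\<close>; in the presence of \<open>zz\<close> the
factor is compensated by scaling \<open>z\<close> by a square root of \<open>-q\<close>.\<close>

lemma isomorphic_relators:
  fixes m n :: "'k::{alg_closed_field, field_char_0} name"
  assumes adm: "admissible m" "admissible n"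
    and mn: "m = n \<or> (\<exists>q. m = Quantum_plane q \<and> n = Quantum_plane (inverse q))
      \<or> (\<exists>q. m = Quantum_Weyl q \<and> n = Quantum_Weyl (inverse q))"
  shows "H (relator m) \<cong>\<^sub>a\<^sub>l\<^sub>g H (relator n)"
proof -
  consider "m = n" | q where "m = Quantum_plane q" "n = Quantum_plane (inverse q)"
    | q where "m = Quantum_Weyl q" "n = Quantum_Weyl (inverse q)"
    using mn by blast
  then have "graded_equiv (relator_matrix m) (relator_matrix n)"
  proof cases
    case 1
    then show ?thesis by (simp add: graded_equiv_refl)
  next
    case 2
    with adm show ?thesis
      unfolding 2 relator_matrix.simps
      by (intro graded_equiv_form[where a = 0 and b = 1 and c = 1 and d = 0 and e = 0 and h = 0
            and l = 1 and m = "- q"]) simp_all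
  next
    case 3
    obtain l where l: "l \<noteq> 0" "l * l * (- 1) = q"
      using adm 3 by (auto intro: scaling_exists[of "-1" q])
    with adm show ?thesis
      unfolding 3 relator_matrix.simps
      by (intro graded_equiv_form[where a = 0 and b = 1 and c = 1 and d = 0 and e = 0 and h = 0
            and l = l and m = "- q"]) (simp_all add: 3)
  qed
  then show ?thesis
    unfolding relator_eq_quad by (rule graded_equiv_imp_isomorphic)
qed

theorem theorem6p1:
  shows "(\<forall>f :: (gen, 'k :: {alg_closed_field, field_char_0}) free_alg.
            homogeneous 2 f \<longrightarrow>
            (\<exists>w \<in> {Word [GX, GX], Word [GX, GY], Word [GY, GX], Word [GY, GY]}.
               Poly_Mapping.lookup f w \<noteq> 0) \<longrightarrow>
            (\<exists>n. admissible n \<and> H f \<cong>\<^sub>a\<^sub>l\<^sub>g H (relator n)))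
       \<and> (\<forall>m n :: 'k name. admissible m \<longrightarrow> admissible n \<longrightarrow>
            (H (relator m) \<cong>\<^sub>a\<^sub>l\<^sub>g H (relator n) \<longleftrightarrow>
               m = n
             \<or> (\<exists>q. m = Quantum_plane q \<and> n = Quantum_plane (inverse q))
             \<or> (\<exists>q. m = Quantum_Weyl q \<and> n = Quantum_Weyl (inverse q))))"
  using exists_isomorphic_relator isomorphic_relators isomorphic_relators_imp by blast

end
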